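(* Let $\alpha>1$ be a real number and, for $x\in(0,1]$, let $(d_i(x))_{i\ge 1}$ denote the digit sequence of the $\alpha$-expansion of $x$. Let $(m_{i})_{i\ge1}$ be a strictly increasing sequence of natural numbers such that $I=\{m_{i} : i\in\mathbb{N}\}$ has an infinite complement $\hat I=\mathbb{N}\setminus I$, and let $f:I\to\mathbb{N}$ be an increasing function. For each $n\in\mathbb{N}$ choose $k_{n}\in\mathbb{N}$ such that $|\hat I\cap\{1,\dots, k_{n}\}|=n$. If \[ \lim_{n\to\infty}\frac{k_{n}}{n}=1\quad\mbox{ and }\quad \lim_{n\to\infty}\frac{1}{n}\sum_{i=1}^{k_{n}-n}f(m_{i})=\mu \] for a real number $\mu>0$, then \[ \dim_{H}\{x\in(0,1] : d_{m_{i}}(x)=f(m_i)\ \text{for all } i\in \mathbb{N}\}=d, \] where $\dim_H$ denotes Hausdorff dimension and $d\in (0,1)$ is the solution of \[ \left(\frac{\alpha-1}{\alpha^{\mu}}\right)^{d} -\alpha^{d}+1=0. \]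
   Context: $\mathbb{N}=\{1,2,3,\dots\}$. Let $\alpha>1$ be real. It is known that every $x\in(0,1]$ can be uniquely written in the form \[ x=\sum_{i=1}^{\infty}(\alpha-1)^{i-1}\alpha^{-(d_{1}(x)+\dots+d_{i}(x))} \] with $(d_i(x))_{i\ge1}\in\mathbb{N}^{\mathbb{N}}$, and conversely every sequence in $\mathbb{N}^{\mathbb{N}}$ defines a point of $(0,1]$ in this way. This is called the $\alpha$-expansion of $x$, and the $d_i(x)$ are its digits. *)

theory Defs
  imports "HOL-Analysis.Analysis"
begin

text \<open>
  Throughout, the natural numbers of the text start at 1 and are rendered as the set
  \<^term>\<open>{1..} :: nat set\<close>. Digit sequences are extensional functions on this set, so that a
  sequence is determined by its values at the indices from 1 on.
\<close>

definition is_alpha_expansion :: "real \<Rightarrow> real \<Rightarrow> (nat \<Rightarrow> nat) \<Rightarrow> bool" where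
  "is_alpha_expansion \<alpha> x d \<longleftrightarrow>
     d \<in> {1..} \<rightarrow>\<^sub>E {1..} \<and>
     (\<lambda>i. (\<alpha> - 1) ^ i / \<alpha> ^ (\<Sum>j=1..Suc i. d j)) sums x"
  \<comment> \<open>The summand at \<open>i\<close> is the term of index \<open>i + 1\<close> of the series that starts at index 1.\<close>

text \<open>Meaningful for \<open>\<alpha> > 1\<close> and \<open>0 < x \<le> 1\<close>, where the expansion exists and is unique.\<close>

definition alpha_digit :: "real \<Rightarrow> nat \<Rightarrow> real \<Rightarrow> nat" where
  "alpha_digit \<alpha> i x = (THE d. is_alpha_expansion \<alpha> x d) i"

text \<open>
  The gauge \<open>diam(U)\<^sup>s\<close>, with the usual conventions \<open>0\<^sup>0 = 1\<close> on nonempty sets (whereas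
  \<open>0 powr 0 = 0\<close> in HOL) and value 0 on the empty set.
\<close>

definition hausdorff_gauge :: "real \<Rightarrow> 'a::metric_space set \<Rightarrow> ennreal" where
  "hausdorff_gauge s U =
     (if U = {} then 0 else if s = 0 then 1 else ennreal (diameter U powr s))"

text \<open>Boundedness is required because \<^const>\<open>diameter\<close> is unspecified on unbounded sets.\<close>

definition hausdorff_covers :: "real \<Rightarrow> 'a::metric_space set \<Rightarrow> (nat \<Rightarrow> 'a set) set" where
  "hausdorff_covers \<delta> E =
     {U. E \<subseteq> (\<Union>i. U i) \<and> (\<forall>i. bounded (U i) \<and> diameter (U i) \<le> \<delta>)}"

definition hausdorff_measure :: "real \<Rightarrow> 'a::metric_space set \<Rightarrow> ennreal" where
  "hausdorff_measure s E =
     (SUP \<delta>\<in>{0<..}. INF U\<in>hausdorff_covers \<delta> E. (\<Sum>i. hausdorff_gauge s (U i)))"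

definition hausdorff_dim :: "'a::metric_space set \<Rightarrow> ennreal" where
  "hausdorff_dim E = (INF s\<in>{s. 0 \<le> s \<and> hausdorff_measure s E = 0}. ennreal s)"

end

theory Submission
  imports Defs "HOL-Probability.Probability"
begin

text \<open>
  Prepending a digit \<open>j\<close> to a digit sequence acts on the value of the expansion as the affine map
  \<open>y \<mapsto> (1 + (\<alpha> - 1) y) / \<alpha>\<^sup>j\<close>. These maps have ratios \<open>(\<alpha> - 1) / \<alpha>\<^sup>j\<close> and send \<open>(0, 1]\<close> onto the
  intervals \<open>(\<alpha>\<^sup>-\<^sup>j, \<alpha>\<^sup>1\<^sup>-\<^sup>j]\<close>, which partition \<open>(0, 1]\<close>. Hence expansions exist and are unique, and
  the set in question is the attractor of a nonautonomous iterated function system: at a free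
  position all maps are used, at a prescribed position only one of them.

  Among the first \<open>N\<close> positions, \<open>N - o(N)\<close> are free and the prescribed digits sum to
  \<open>\<mu> N + o(N)\<close>. Per free digit the prescribed ones therefore contribute, up to subexponential
  factors, a contraction by \<open>\<alpha>\<^sup>-\<^sup>\<mu>\<close>. So the dimension should solve the Moran equation of the ratios
  \<open>\<theta> \<alpha>\<^sup>-\<^sup>j\<close> with \<open>\<theta> = (\<alpha> - 1) / \<alpha>\<^sup>\<mu>\<close>, namely \<open>1 = \<Sum>j\<ge>1. (\<theta> \<alpha>\<^sup>-\<^sup>j)\<^sup>d = \<theta>\<^sup>d / (\<alpha>\<^sup>d - 1)\<close>, which is the
  equation of the theorem. Dividing it by \<open>\<alpha>\<^sup>d\<close> leaves a strictly decreasing function of \<open>d\<close>, so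
  the root is unique and the sign of \<open>\<theta>\<^sup>s - \<alpha>\<^sup>s + 1\<close> tells whether \<open>s\<close> lies above or below it.

  If \<open>s > d\<close>, the cylinders of level \<open>N\<close> have a total \<open>s\<close>-gauge that decays exponentially in \<open>N\<close>;
  see \<open>coverable_expansion_values\<close> and \<open>hausdorff_measure_prescribed_zero\<close>.

  If \<open>0 < s < d\<close>, the sum of \<open>(\<theta> \<alpha>\<^sup>-\<^sup>j)\<^sup>s\<close> over \<open>j \<le> M\<close> already exceeds 1 for some finite \<open>M\<close>. Drawing
  the free digits independently from \<open>{1..M}\<close> with probabilities proportional to \<open>\<alpha>\<^sup>-\<^sup>s\<^sup>j\<close> gives a
  product measure on digit sequences. Two sequences that first differ at position \<open>N\<close> have values
  separated by at least the term of index \<open>N + 1\<close> of the larger value (\<open>expansion_value_gap\<close>).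
  The excess of the sum over 1 is an exponential gain that absorbs all subexponential errors, so
  the measure of a cylinder is at most a constant times the \<open>s\<close>-th power of that separation. The mass
  distribution principle (\<open>hausdorff_cover_sum_lower_bound\<close>) then bounds the gauge sum of every cover
  from below; see \<open>hausdorff_covers_prescribed_lower_bound\<close>.
\<close>

section \<open>Values of digit sequences, existence and uniqueness of expansions\<close>

text \<open>
  Digit positions start at 0 here, so that dropping the first digit is composition with
  \<^const>\<open>Suc\<close> and induction on positions has its usual form.
\<close>

definition expansion_term :: "real \<Rightarrow> (nat \<Rightarrow> nat) \<Rightarrow> nat \<Rightarrow> real" where
  "expansion_term \<alpha> e i = (\<alpha> - 1) ^ i / \<alpha> ^ (\<Sum>j\<le>i. e j)"

definition expansion_value :: "real \<Rightarrow> (nat \<Rightarrow> nat) \<Rightarrow> real" where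
  "expansion_value \<alpha> e = (\<Sum>i. expansion_term \<alpha> e i)"

context
  fixes \<alpha> :: real
  assumes alpha_gt_1: "\<alpha> > 1"
begin

lemma expansion_term_pos: "expansion_term \<alpha> e i > 0"
  using alpha_gt_1 by (simp add: expansion_term_def)

text \<open>
  Digits are at least 1, so the constant sequence 1, whose value is exactly 1, gives the largest
  terms.
\<close>

lemma expansion_term_le_geometric:
  assumes "\<And>i. e i \<ge> 1"
  shows "expansion_term \<alpha> e i \<le> ((\<alpha> - 1) / \<alpha>) ^ i * (1 / \<alpha>)"
proof -
  have "Suc i = (\<Sum>j\<le>i. 1)" by simp
  also have "\<dots> \<le> (\<Sum>j\<le>i. e j)" by (rule sum_mono) (use assms in auto)
  finally have "\<alpha> ^ Suc i \<le> \<alpha> ^ (\<Sum>j\<le>i. e j)"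
    using alpha_gt_1 by (intro power_increasing) auto
  then have "expansion_term \<alpha> e i \<le> (\<alpha> - 1) ^ i / \<alpha> ^ Suc i"
    unfolding expansion_term_def using alpha_gt_1 by (intro divide_left_mono) auto
  also have "\<dots> = ((\<alpha> - 1) / \<alpha>) ^ i * (1 / \<alpha>)"
    by (simp add: power_divide)
  finally show ?thesis .
qed

lemma geometric_majorant_sums: "(\<lambda>i. ((\<alpha> - 1) / \<alpha>) ^ i * (1 / \<alpha>)) sums 1"
proof -
  have "(\<lambda>i. ((\<alpha> - 1) / \<alpha>) ^ i * (1 / \<alpha>)) sums (1 / (1 - (\<alpha> - 1) / \<alpha>) * (1 / \<alpha>))"
    using alpha_gt_1 by (intro sums_mult2 geometric_sums) auto
  also have "1 / (1 - (\<alpha> - 1) / \<alpha>) * (1 / \<alpha>) = 1"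
    using alpha_gt_1 by (simp add: field_simps)
  finally show ?thesis .
qed

lemma expansion_term_summable:
  assumes "\<And>i. e i \<ge> 1"
  shows "summable (expansion_term \<alpha> e)"
proof (rule summable_comparison_test'[where N = 0])
  show "summable (\<lambda>i. ((\<alpha> - 1) / \<alpha>) ^ i * (1 / \<alpha>))"
    using geometric_majorant_sums by (rule sums_summable)
  show "norm (expansion_term \<alpha> e n) \<le> ((\<alpha> - 1) / \<alpha>) ^ n * (1 / \<alpha>)" for n
    using expansion_term_le_geometric[of e n] expansion_term_pos[of e n] assms by simp
qed

lemma expansion_value_bounds:
  assumes "\<And>i. e i \<ge> 1"
  shows "0 < expansion_value \<alpha> e" "expansion_value \<alpha> e \<le> 1"
proof -
  show "0 < expansion_value \<alpha> e"
    unfolding expansion_value_def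
    by (rule suminf_pos[OF expansion_term_summable]) (use assms expansion_term_pos in auto)
  have "expansion_value \<alpha> e \<le> (\<Sum>i. ((\<alpha> - 1) / \<alpha>) ^ i * (1 / \<alpha>))"
    unfolding expansion_value_def
    using expansion_term_le_geometric expansion_term_summable assms geometric_majorant_sums
    by (intro suminf_le) (auto dest: sums_summable)
  also have "\<dots> = 1" using geometric_majorant_sums by (rule sums_unique[symmetric])
  finally show "expansion_value \<alpha> e \<le> 1" .
qed

lemma expansion_term_Suc:
  "expansion_term \<alpha> e (Suc i) = (\<alpha> - 1) / \<alpha> ^ e 0 * expansion_term \<alpha> (\<lambda>i. e (Suc i)) i"
  by (simp add: expansion_term_def sum.atMost_Suc_shift power_add del: sum.atMost_Suc)

lemma expansion_value_rec:
  assumes "\<And>i. e i \<ge> 1"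
  shows "expansion_value \<alpha> e = (1 + (\<alpha> - 1) * expansion_value \<alpha> (\<lambda>i. e (Suc i))) / \<alpha> ^ e 0"
proof -
  have "expansion_value \<alpha> e = expansion_term \<alpha> e 0 + (\<Sum>i. expansion_term \<alpha> e (Suc i))"
    unfolding expansion_value_def
    using suminf_split_head[OF expansion_term_summable[OF assms]] by simp
  also have "(\<Sum>i. expansion_term \<alpha> e (Suc i)) =
      (\<alpha> - 1) / \<alpha> ^ e 0 * expansion_value \<alpha> (\<lambda>i. e (Suc i))"
    unfolding expansion_term_Suc expansion_value_def
    by (rule suminf_mult[OF expansion_term_summable]) (rule assms)
  finally show ?thesis by (simp add: expansion_term_def add_divide_distrib)
qed

text \<open>
  The self-similarity reduces this to sequences that differ in their first digit. There both
  values are compared with the left end \<open>1 / \<alpha> ^ e 0\<close> of the first-level interval of \<open>e\<close>: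
  since values are at most 1, that of \<open>e'\<close> does not exceed it, while that of \<open>e\<close> exceeds it by
  its remaining terms, of which only the next one is kept.
\<close>

lemma expansion_value_gap:
  assumes "\<And>i. e i \<ge> 1" "\<And>i. e' i \<ge> 1" "\<And>i. i < N \<Longrightarrow> e i = e' i" "e N < e' N"
  shows "expansion_value \<alpha> e' + expansion_term \<alpha> e (Suc N) \<le> expansion_value \<alpha> e"
  using assms
proof (induction N arbitrary: e e')
  case 0
  let ?v = "expansion_value \<alpha>"
  let ?s = "\<lambda>e i. e (Suc i) :: nat"
  have r: "?v e = (1 + (\<alpha> - 1) * ?v (?s e)) / \<alpha> ^ e 0"
          "?v e' = (1 + (\<alpha> - 1) * ?v (?s e')) / \<alpha> ^ e' 0"
    using 0 by (auto intro: expansion_value_rec)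
  have t: "expansion_term \<alpha> e (Suc 0) = (\<alpha> - 1) / \<alpha> ^ e 0 * (1 / \<alpha> ^ e 1)"
    by (simp add: expansion_term_def power_add)
  have "1 / \<alpha> ^ e 1 \<le> ?v (?s e)"
  proof -
    have "?v (?s e) = (1 + (\<alpha> - 1) * ?v (?s (?s e))) / \<alpha> ^ e 1"
      using expansion_value_rec[of "?s e"] 0 by auto
    moreover have "0 < ?v (?s (?s e))" using 0 by (intro expansion_value_bounds) auto
    ultimately show ?thesis using alpha_gt_1 by (auto intro!: divide_right_mono)
  qed
  then have "(\<alpha> - 1) / \<alpha> ^ e 0 * (1 / \<alpha> ^ e 1) \<le> (\<alpha> - 1) / \<alpha> ^ e 0 * ?v (?s e)"
    using alpha_gt_1 by (intro mult_left_mono) auto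
  \<comment> \<open>Since \<open>e' 0 \<ge> e 0 + 1\<close>, the whole first-level interval of \<open>e'\<close> lies below this point.\<close>
  moreover have "?v e' \<le> 1 / \<alpha> ^ e 0"
  proof -
    have "?v (?s e') \<le> 1" using 0 by (intro expansion_value_bounds) auto
    then have "?v e' \<le> (1 + (\<alpha> - 1) * 1) / \<alpha> ^ e' 0"
      unfolding r using alpha_gt_1 by (intro divide_right_mono add_left_mono mult_left_mono) auto
    also have "\<dots> \<le> \<alpha> / \<alpha> ^ Suc (e 0)"
    proof -
      have "\<alpha> ^ Suc (e 0) \<le> \<alpha> ^ e' 0"
        using alpha_gt_1 0 by (intro power_increasing) auto
      then have "\<alpha> / \<alpha> ^ e' 0 \<le> \<alpha> / \<alpha> ^ Suc (e 0)"
        using alpha_gt_1 by (intro divide_left_mono) auto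
      then show ?thesis by simp
    qed
    also have "\<dots> = 1 / \<alpha> ^ e 0" using alpha_gt_1 by simp
    finally show ?thesis .
  qed
  ultimately show ?case unfolding t r(1) by (simp add: add_divide_distrib)
next
  case (Suc N)
  let ?v = "expansion_value \<alpha>"
  let ?s = "\<lambda>e i. e (Suc i) :: nat"
  have r: "?v e = (1 + (\<alpha> - 1) * ?v (?s e)) / \<alpha> ^ e 0"
          "?v e' = (1 + (\<alpha> - 1) * ?v (?s e')) / \<alpha> ^ e 0"
    using Suc.prems expansion_value_rec[of e] expansion_value_rec[of e'] by auto
  have "?v (?s e') + expansion_term \<alpha> (?s e) (Suc N) \<le> ?v (?s e)"
    using Suc.prems by (intro Suc.IH) auto
  then have "(\<alpha> - 1) / \<alpha> ^ e 0 * (?v (?s e') + expansion_term \<alpha> (?s e) (Suc N))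
     \<le> (\<alpha> - 1) / \<alpha> ^ e 0 * ?v (?s e)"
    using alpha_gt_1 by (intro mult_left_mono) auto
  then show ?case unfolding r expansion_term_Suc[of e] by (simp add: add_divide_distrib distrib_left)
qed

lemma expansion_value_inj:
  assumes "\<And>i. e i \<ge> 1" "\<And>i. e' i \<ge> 1" "expansion_value \<alpha> e = expansion_value \<alpha> e'"
  shows "e = e'"
proof (rule ccontr)
  assume "e \<noteq> e'"
  then have "\<exists>n. e n \<noteq> e' n" by auto
  then have N: "e (LEAST n. e n \<noteq> e' n) \<noteq> e' (LEAST n. e n \<noteq> e' n)" by (rule LeastI_ex)
  define N where "N = (LEAST n. e n \<noteq> e' n)"
  have eq: "e i = e' i" if "i < N" for i using that not_less_Least unfolding N_def by blast
  from N consider "e N < e' N" | "e' N < e N" unfolding N_def by linarith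
  then show False
  proof cases
    case 1
    then show ?thesis
      using expansion_value_gap[of e e' N] expansion_term_pos[of e "Suc N"] eq assms by auto
  next
    case 2
    then show ?thesis
      using expansion_value_gap[of e' e N] expansion_term_pos[of e' "Suc N"] eq assms by auto
  qed
qed

text \<open>
  The half-open intervals \<open>(\<alpha>\<^sup>-\<^sup>j, \<alpha>\<^sup>1\<^sup>-\<^sup>j]\<close> with \<open>j \<ge> 1\<close> cover \<open>(0, 1]\<close>; the digit is the index of the one
  that contains \<open>x\<close>, and \<open>y\<close> is the relative position of \<open>x\<close> in it.
\<close>

lemma greedy_digit_exists:
  assumes "0 < x" "x \<le> 1"
  shows "\<exists>j y. 1 \<le> j \<and> 0 < y \<and> y \<le> 1 \<and> x = (1 + (\<alpha> - 1) * y) / \<alpha> ^ j"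
proof -
  have "\<exists>j. (1 / \<alpha>) ^ j < x"
    using assms alpha_gt_1 by (intro real_arch_pow_inv) auto
  then have ex: "\<exists>j. 1 / \<alpha> ^ j < x" by (simp add: power_one_over)
  define j where "j = (LEAST j. 1 / \<alpha> ^ j < x)"
  have less: "1 / \<alpha> ^ j < x" unfolding j_def by (rule LeastI_ex) (rule ex)
  then have "j \<noteq> 0" using assms by (intro notI) auto
  then obtain l where l: "j = Suc l" using not0_implies_Suc by blast
  then have "l < (LEAST j. 1 / \<alpha> ^ j < x)" unfolding j_def by linarith
  then have ge: "x \<le> 1 / \<alpha> ^ l" using not_less_Least not_le by blast
  define y where "y = (\<alpha> ^ j * x - 1) / (\<alpha> - 1)"
  have "x = (1 + (\<alpha> - 1) * y) / \<alpha> ^ j" unfolding y_def using alpha_gt_1 by simp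
  moreover have "0 < y" unfolding y_def using less alpha_gt_1 by (simp add: field_simps)
  moreover have "y \<le> 1" unfolding y_def l using ge alpha_gt_1
    by (simp add: field_simps)
  ultimately show ?thesis using l by (intro exI[of _ j] exI[of _ y]) auto
qed

text \<open>
  Iterating the greedy choice of a digit produces a sequence. For every \<open>n\<close>, the point and the value
  of its greedy sequence are the images of two points of \<open>[0, 1]\<close> under the same composition of \<open>n\<close>
  contractions, hence they coincide.
\<close>

lemma expansion_exists:
  assumes "0 < x" "x \<le> 1"
  shows "\<exists>e. (\<forall>i. e i \<ge> 1) \<and> expansion_value \<alpha> e = x"
proof -
  have "\<forall>x. \<exists>j y. 0 < x \<and> x \<le> 1 \<longrightarrow> 1 \<le> j \<and> 0 < y \<and> y \<le> 1 \<and> x = (1 + (\<alpha> - 1) * y) / \<alpha> ^ j"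
    using greedy_digit_exists by metis
  then obtain J :: "real \<Rightarrow> nat" and Y where JY: "\<And>x. 0 < x \<Longrightarrow> x \<le> 1 \<Longrightarrow>
      1 \<le> J x \<and> 0 < Y x \<and> Y x \<le> 1 \<and> x = (1 + (\<alpha> - 1) * Y x) / \<alpha> ^ J x" by metis
  define e where "e x i = J ((Y ^^ i) x)" for x i
  have inside: "0 < (Y ^^ i) x \<and> (Y ^^ i) x \<le> 1" if "0 < x" "x \<le> 1" for i x
    using that JY by (induction i) auto
  then have e1: "e x i \<ge> 1" if "0 < x" "x \<le> 1" for i x
    unfolding e_def using that JY by auto
  have shift: "(\<lambda>i. e x (Suc i)) = e (Y x)" for x
    unfolding e_def by (simp add: funpow_Suc_right del: funpow.simps)
  let ?r = "(\<alpha> - 1) / \<alpha>"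
  have contr: "\<bar>x - expansion_value \<alpha> (e x)\<bar> \<le> ?r ^ n" if "0 < x" "x \<le> 1" for n x
    using that
  proof (induction n arbitrary: x)
    case 0
    then show ?case using expansion_value_bounds[of "e x"] e1[of x] by auto
  next
    case (Suc n)
    have v: "expansion_value \<alpha> (e x) = (1 + (\<alpha> - 1) * expansion_value \<alpha> (e (Y x))) / \<alpha> ^ J x"
      using expansion_value_rec[of "e x"] e1[OF Suc.prems] unfolding shift by (simp add: e_def)
    have "x - expansion_value \<alpha> (e x) = (\<alpha> - 1) / \<alpha> ^ J x * (Y x - expansion_value \<alpha> (e (Y x)))"
      using JY[OF Suc.prems] unfolding v by (metis (no_types, lifting) add_diff_cancel_left diff_divide_distrib right_diff_distrib times_divide_eq_left)
    then have "\<bar>x - expansion_value \<alpha> (e x)\<bar> = (\<alpha> - 1) / \<alpha> ^ J x * \<bar>Y x - expansion_value \<alpha> (e (Y x))\<bar>"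
      using alpha_gt_1 by (simp add: abs_mult)
    also have "\<dots> \<le> ?r * ?r ^ n"
    proof (rule mult_mono)
      have "\<alpha> ^ 1 \<le> \<alpha> ^ J x" using alpha_gt_1 JY[OF Suc.prems] by (intro power_increasing) auto
      then show "(\<alpha> - 1) / \<alpha> ^ J x \<le> ?r" using alpha_gt_1 by (intro divide_left_mono) auto
      show "\<bar>Y x - expansion_value \<alpha> (e (Y x))\<bar> \<le> ?r ^ n"
        using JY[OF Suc.prems] by (intro Suc.IH) auto
    qed (use alpha_gt_1 in auto)
    finally show ?case by simp
  qed
  have "(\<lambda>n. ?r ^ n) \<longlonglongrightarrow> 0" using alpha_gt_1 by (intro LIMSEQ_power_zero) auto
  then have "\<bar>x - expansion_value \<alpha> (e x)\<bar> \<le> 0"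
    by (rule LIMSEQ_le_const) (use contr assms in auto)
  then show ?thesis using e1 assms by (intro exI[of _ "e x"]) auto
qed

lemma is_alpha_expansion_iff:
  "is_alpha_expansion \<alpha> x d \<longleftrightarrow>
     d \<in> {1..} \<rightarrow>\<^sub>E {1..} \<and> expansion_value \<alpha> (\<lambda>i. d (Suc i)) = x"
proof -
  have eq: "(\<alpha> - 1) ^ i / \<alpha> ^ (\<Sum>j=1..Suc i. d j) = expansion_term \<alpha> (\<lambda>i. d (Suc i)) i" for i
  proof -
    have "(\<Sum>j=1..Suc i. d j) = (\<Sum>j\<le>i. d (Suc j))"
      by (simp only: One_nat_def sum.shift_bounds_cl_Suc_ivl atLeast0AtMost)
    then show ?thesis by (simp add: expansion_term_def)
  qed
  have "summable (expansion_term \<alpha> (\<lambda>i. d (Suc i)))" if "d \<in> {1..} \<rightarrow>\<^sub>E {1..}"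
    using that by (intro expansion_term_summable) auto
  then show ?thesis
    unfolding is_alpha_expansion_def eq expansion_value_def
    by (auto simp: sums_iff)
qed

text \<open>
  The link to the definite description in \<^const>\<open>alpha_digit\<close>, with the shift of indices by 1.
\<close>

lemma alpha_digit_expansion_value:
  assumes "\<And>i. e i \<ge> 1"
  shows "alpha_digit \<alpha> (Suc i) (expansion_value \<alpha> e) = e i"
proof -
  define d where "d = (\<lambda>i. if 1 \<le> i then e (i - 1) else undefined)"
  have "(THE d. is_alpha_expansion \<alpha> (expansion_value \<alpha> e) d) = d"
  proof (rule the_equality)
    show "is_alpha_expansion \<alpha> (expansion_value \<alpha> e) d"
      using assms by (auto simp: is_alpha_expansion_iff d_def split: if_splits)
    fix d' assume d': "is_alpha_expansion \<alpha> (expansion_value \<alpha> e) d'"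
    then have d'_PiE: "d' \<in> {1..} \<rightarrow>\<^sub>E {1..}"
      and val: "expansion_value \<alpha> (\<lambda>i. d' (Suc i)) = expansion_value \<alpha> e"
      by (auto simp: is_alpha_expansion_iff)
    have "(\<lambda>i. d' (Suc i)) = e"
      using d'_PiE by (intro expansion_value_inj assms val) auto
    then have "d' (Suc i) = e i" for i by metis
    then show "d' = d"
      using d'_PiE by (intro ext) (auto simp: d_def gr0_conv_Suc PiE_def extensional_def Suc_le_eq)
  qed
  then show ?thesis unfolding alpha_digit_def by (simp add: d_def)
qed

end

section \<open>Hausdorff measure from above: covers by cylinders\<close>

text \<open>
  \<open>coverable s \<delta> c A\<close> bounds the \<open>\<delta>\<close>-premeasure of \<open>A\<close> by \<open>c\<close>, but with an actual cover as a
  witness rather than an infimum. Such bounds can be added and rescaled without any loss, which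
  suits an induction over levels.
\<close>

definition coverable :: "real \<Rightarrow> real \<Rightarrow> ennreal \<Rightarrow> 'a::metric_space set \<Rightarrow> bool" where
  "coverable s \<delta> c A \<longleftrightarrow> (\<exists>U\<in>hausdorff_covers \<delta> A. (\<Sum>i. hausdorff_gauge s (U i)) \<le> c)"

lemma coverable_bounded:
  assumes "bounded A" "diameter A \<le> \<delta>" "0 \<le> \<delta>"
  shows "coverable s \<delta> (hausdorff_gauge s A) A"
proof -
  define U where "U i = (if i = (0::nat) then A else {})" for i
  have "U 0 \<subseteq> (\<Union>i. U i)" by (rule UN_upper) simp
  then have "A \<subseteq> (\<Union>i. U i)" by (simp add: U_def)
  moreover have "bounded (U i) \<and> diameter (U i) \<le> \<delta>" for i
    using assms by (simp add: U_def)
  ultimately have "U \<in> hausdorff_covers \<delta> A"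
    by (simp add: hausdorff_covers_def)
  moreover have "(\<Sum>i. hausdorff_gauge s (U i)) = (\<Sum>i\<in>{0}. hausdorff_gauge s (U i))"
    by (rule suminf_finite) (auto simp: U_def hausdorff_gauge_def)
  then have "(\<Sum>i. hausdorff_gauge s (U i)) \<le> hausdorff_gauge s A" by (simp add: U_def)
  ultimately show ?thesis unfolding coverable_def by blast
qed

lemma coverable_empty: "0 \<le> \<delta> \<Longrightarrow> coverable s \<delta> 0 {}"
  using coverable_bounded[of "{}" \<delta> s] by (simp add: hausdorff_gauge_def)

lemma coverable_mono:
  assumes "coverable s \<delta> c A" "B \<subseteq> A" "\<delta> \<le> \<delta>'" "c \<le> c'"
  shows "coverable s \<delta>' c' B"
proof -
  obtain U where "U \<in> hausdorff_covers \<delta> A" "(\<Sum>i. hausdorff_gauge s (U i)) \<le> c"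
    using assms by (auto simp: coverable_def)
  then have "U \<in> hausdorff_covers \<delta>' B" "(\<Sum>i. hausdorff_gauge s (U i)) \<le> c'"
    using assms by (auto simp: hausdorff_covers_def intro: order_trans)
  then show ?thesis unfolding coverable_def by blast
qed

lemma coverable_UN:
  assumes "\<And>j::nat. coverable s \<delta> (c j) (A j)"
  shows "coverable s \<delta> (\<Sum>j. c j) (\<Union>j. A j)"
proof -
  obtain U where U: "\<And>j. U j \<in> hausdorff_covers \<delta> (A j)"
      "\<And>j. (\<Sum>i. hausdorff_gauge s (U j i)) \<le> c j"
    using assms unfolding coverable_def by metis
  define V where "V n = case_prod U (prod_decode n)" for n
  have "(\<Union>j. A j) \<subseteq> (\<Union>n. V n)"
  proof
    fix x assume "x \<in> (\<Union>j. A j)"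
    then obtain j where "x \<in> A j" by blast
    moreover have "A j \<subseteq> (\<Union>i. U j i)" using U(1)[of j] by (simp add: hausdorff_covers_def)
    ultimately obtain i where "x \<in> U j i" by blast
    then have "x \<in> V (prod_encode (j, i))" by (simp add: V_def)
    then show "x \<in> (\<Union>n. V n)" by blast
  qed
  moreover have "bounded (V n) \<and> diameter (V n) \<le> \<delta>" for n
    using U(1) by (auto simp: V_def hausdorff_covers_def split: prod.split)
  ultimately have "V \<in> hausdorff_covers \<delta> (\<Union>j. A j)" by (auto simp: hausdorff_covers_def)
  moreover have "(\<Sum>n. hausdorff_gauge s (V n)) \<le> (\<Sum>j. c j)"
  proof -
    have "(\<Sum>n. hausdorff_gauge s (V n)) =
        (\<Sum>n. (\<lambda>(j, i). hausdorff_gauge s (U j i)) (prod_decode n))"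
      by (simp add: V_def case_prod_beta)
    also have "\<dots> = (\<Sum>j. \<Sum>i. hausdorff_gauge s (U j i))"
      by (rule suminf_ennreal_2dimen) simp
    also have "\<dots> \<le> (\<Sum>j. c j)" using U(2) by (intro suminf_le) auto
    finally show ?thesis .
  qed
  ultimately show ?thesis unfolding coverable_def by blast
qed

lemma lipschitz_image_diameter:
  assumes "L-lipschitz_on A f" "bounded A"
  shows "bounded (f ` A)" "diameter (f ` A) \<le> L * diameter A"
proof -
  have d: "dist (f x) (f y) \<le> L * diameter A" if "x \<in> A" "y \<in> A" for x y
  proof -
    have "dist (f x) (f y) \<le> L * dist x y" using assms that by (auto dest: lipschitz_onD)
    also have "\<dots> \<le> L * diameter A"
      using diameter_bounded_bound[OF assms(2) that] lipschitz_on_nonneg[OF assms(1)]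
      by (rule mult_left_mono)
    finally show ?thesis .
  qed
  then show "bounded (f ` A)" by (auto simp: bounded_two_points)
  show "diameter (f ` A) \<le> L * diameter A"
  proof (cases "A = {}")
    case True
    then show ?thesis by simp
  next
    case False
    then show ?thesis using d unfolding diameter_def by (auto intro!: cSUP_least)
  qed
qed

lemma coverable_lipschitz_image:
  assumes "coverable s \<delta> c A" "L-lipschitz_on UNIV f" "s > 0"
  shows "coverable s (L * \<delta>) (ennreal (L powr s) * c) (f ` A)"
proof -
  obtain U where U: "U \<in> hausdorff_covers \<delta> A" "(\<Sum>i. hausdorff_gauge s (U i)) \<le> c"
    using assms(1) by (auto simp: coverable_def)
  have L: "L \<ge> 0" using assms(2) by (rule lipschitz_on_nonneg)
  have lip: "L-lipschitz_on B f" for B using assms(2) by (rule lipschitz_on_subset) auto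
  have bd: "bounded (U i)" "diameter (U i) \<le> \<delta>" for i
    using U(1) by (auto simp: hausdorff_covers_def)
  have fU: "bounded (f ` U i)" "diameter (f ` U i) \<le> L * diameter (U i)" for i
    using lipschitz_image_diameter[OF lip bd(1)] by auto
  have "f ` A \<subseteq> (\<Union>i. f ` U i)"
    using U(1) by (subst image_UN[symmetric]) (auto simp: hausdorff_covers_def)
  moreover have "diameter (f ` U i) \<le> L * \<delta>" for i
    using fU(2)[of i] mult_left_mono[OF bd(2)[of i] L] by linarith
  ultimately have "(\<lambda>i. f ` U i) \<in> hausdorff_covers (L * \<delta>) (f ` A)"
    using fU(1) by (simp add: hausdorff_covers_def)
  moreover have "(\<Sum>i. hausdorff_gauge s (f ` U i)) \<le> ennreal (L powr s) * c"
  proof -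
    have "hausdorff_gauge s (f ` U i) \<le> ennreal (L powr s) * hausdorff_gauge s (U i)" for i
    proof (cases "U i = {}")
      case False
      have "diameter (f ` U i) powr s \<le> (L * diameter (U i)) powr s"
        using fU assms(3) diameter_ge_0[OF fU(1)] by (intro powr_mono2) auto
      also have "\<dots> = L powr s * diameter (U i) powr s"
        by (rule powr_mult)
      finally show ?thesis
        using False assms(3) by (simp add: hausdorff_gauge_def ennreal_leI flip: ennreal_mult)
    qed (simp add: hausdorff_gauge_def)
    then have "(\<Sum>i. hausdorff_gauge s (f ` U i)) \<le>
        (\<Sum>i. ennreal (L powr s) * hausdorff_gauge s (U i))"
      by (intro suminf_le) auto
    also have "\<dots> = ennreal (L powr s) * (\<Sum>i. hausdorff_gauge s (U i))"
      by simp
    also have "\<dots> \<le> ennreal (L powr s) * c"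
      using U(2) by (rule mult_left_mono) simp
    finally show ?thesis .
  qed
  ultimately show ?thesis unfolding coverable_def by (intro bexI[of _ "\<lambda>i. f ` U i"])
qed

lemma hausdorff_measure_zeroI:
  assumes cov: "\<And>n. coverable s (\<delta> n) (c n) A" and "\<delta> \<longlonglongrightarrow> 0" "c \<longlonglongrightarrow> 0"
  shows "hausdorff_measure s A = 0"
proof -
  have "(INF U\<in>hausdorff_covers \<eta> A. \<Sum>i. hausdorff_gauge s (U i)) = 0" if "\<eta> > 0" for \<eta>
  proof -
    let ?I = "INF U\<in>hausdorff_covers \<eta> A. \<Sum>i. hausdorff_gauge s (U i)"
    have "\<forall>\<^sub>F n in sequentially. \<delta> n < \<eta>" using \<open>\<delta> \<longlonglongrightarrow> 0\<close> that by (rule order_tendstoD)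
    then have "\<forall>\<^sub>F n in sequentially. ?I \<le> c n"
    proof eventually_elim
      case (elim n)
      then have "coverable s \<eta> (c n) A" using cov[of n] by (intro coverable_mono[OF cov[of n]]) auto
      then obtain U where "U \<in> hausdorff_covers \<eta> A" "(\<Sum>i. hausdorff_gauge s (U i)) \<le> c n"
        by (auto simp: coverable_def)
      then show ?case by (intro INF_lower2[of U])
    qed
    then have "?I \<le> 0" using \<open>c \<longlonglongrightarrow> 0\<close> by (intro tendsto_lowerbound[of c]) auto
    then show ?thesis by simp
  qed
  then show ?thesis unfolding hausdorff_measure_def
    by (intro SUP_eq_const) auto
qed

lemma hausdorff_dim_leI:
  assumes "\<And>s. d < s \<Longrightarrow> hausdorff_measure s A = 0" "0 \<le> d"
  shows "hausdorff_dim A \<le> ennreal d"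
proof (rule ennreal_le_epsilon)
  fix \<epsilon> :: real assume "\<epsilon> > 0"
  then have "hausdorff_dim A \<le> ennreal (d + \<epsilon>)"
    unfolding hausdorff_dim_def using assms by (intro INF_lower) auto
  then show "hausdorff_dim A \<le> ennreal d + ennreal \<epsilon>"
    using assms(2) \<open>\<epsilon> > 0\<close> by (simp add: ennreal_plus)
qed

lemma hausdorff_gauge_antimono:
  assumes "bounded U" "diameter U \<le> 1" "0 \<le> s" "s < t"
  shows "hausdorff_gauge t U \<le> hausdorff_gauge s U"
proof -
  have "diameter U powr t \<le> 1"
    using assms diameter_ge_0[OF assms(1)] by (intro powr_le1) auto
  moreover have "diameter U powr t \<le> diameter U powr s"
    using assms diameter_ge_0[OF assms(1)] by (intro powr_mono') auto
  ultimately show ?thesis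
    using assms by (auto simp: hausdorff_gauge_def intro!: ennreal_leI)
qed

text \<open>
  When the sets of a cover have diameter at most 1, gauges decrease with the exponent. A bound at
  an exponent between \<open>s\<close> and \<open>d\<close> therefore excludes \<open>s\<close>; this also takes care of \<open>s = 0\<close>,
  where the gauge has a special form.
\<close>

lemma hausdorff_dim_geI:
  assumes "\<And>t. 0 < t \<Longrightarrow> t < d \<Longrightarrow>
      \<exists>c>0. \<forall>U\<in>hausdorff_covers 1 A. c \<le> (\<Sum>i. hausdorff_gauge t (U i))"
  shows "ennreal d \<le> hausdorff_dim A"
  unfolding hausdorff_dim_def
proof (rule INF_greatest, clarify)
  fix s :: real assume s: "0 \<le> s" "hausdorff_measure s A = 0"
  show "ennreal d \<le> ennreal s"
  proof (rule ccontr)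
    assume "\<not> ennreal d \<le> ennreal s"
    then have "s < d" using ennreal_leI not_less by blast
    then obtain t where t: "s < t" "t < d" using dense by blast
    then obtain c where c: "c > 0" "\<And>U. U \<in> hausdorff_covers 1 A \<Longrightarrow> c \<le> (\<Sum>i. hausdorff_gauge t (U i))"
      using assms[of t] s by auto
    have "c \<le> (INF U\<in>hausdorff_covers 1 A. \<Sum>i. hausdorff_gauge s (U i))"
    proof (rule INF_greatest)
      fix U assume U: "U \<in> hausdorff_covers 1 A"
      then have "c \<le> (\<Sum>i. hausdorff_gauge t (U i))" by (rule c)
      also have "\<dots> \<le> (\<Sum>i. hausdorff_gauge s (U i))"
        using U s t by (intro suminf_le hausdorff_gauge_antimono) (auto simp: hausdorff_covers_def)
      finally show "c \<le> (\<Sum>i. hausdorff_gauge s (U i))" .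
    qed
    also have "\<dots> \<le> hausdorff_measure s A"
      unfolding hausdorff_measure_def by (rule SUP_upper) simp
    finally show False using c(1) s(2) by simp
  qed
qed

context
  fixes \<alpha> :: real
  assumes alpha_gt_1: "\<alpha> > 1"
begin

text \<open>
  Splitting by the first digit writes the set as a union of affine images of the set of the shifted
  constraints. Each level multiplies the mesh by at most \<open>(\<alpha> - 1) / \<alpha>\<close>, the largest ratio, and the
  total gauge by the sum of the \<open>s\<close>-th powers of the admitted ratios.
\<close>

lemma coverable_expansion_values:
  assumes "s > 0" "\<And>i. D i \<subseteq> {1..}"
  shows "coverable s (((\<alpha> - 1) / \<alpha>) ^ N)
    (\<Prod>i<N. \<Sum>j. if j \<in> D i then ennreal (((\<alpha> - 1) / \<alpha> ^ j) powr s) else 0)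
    (expansion_value \<alpha> ` Pi UNIV D)"
  using assms(2)
proof (induction N arbitrary: D)
  case 0
  have "expansion_value \<alpha> ` Pi UNIV D \<subseteq> {0..1}"
  proof clarify
    fix e assume "e \<in> Pi UNIV D"
    then have "\<And>i. e i \<ge> 1" using 0 by (fastforce simp: Pi_iff)
    then show "expansion_value \<alpha> e \<in> {0..1}"
      using expansion_value_bounds[OF alpha_gt_1, of e] by simp
  qed
  moreover have "coverable s 1 1 {0..1::real}"
    using coverable_bounded[of "{0..1::real}" 1 s] assms(1)
    by (simp add: hausdorff_gauge_def)
  ultimately have "coverable s 1 1 (expansion_value \<alpha> ` Pi UNIV D)"
    using coverable_mono by blast
  then show ?case by simp
next
  case (Suc N)
  let ?r = "(\<alpha> - 1) / \<alpha>"
  define w where "w i j = (if j \<in> D i then ennreal (((\<alpha> - 1) / \<alpha> ^ j) powr s) else 0)" for i j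
  define E where "E = expansion_value \<alpha> ` Pi UNIV (\<lambda>i. D (Suc i))"
  define A where "A j = (if j \<in> D 0 then (\<lambda>y. (1 + (\<alpha> - 1) * y) / \<alpha> ^ j) ` E else {})" for j
  have IH: "coverable s (?r ^ N) (\<Prod>i<N. \<Sum>j. w (Suc i) j) E"
    unfolding E_def w_def using Suc.prems by (intro Suc.IH) auto
  have "coverable s (?r ^ Suc N) (w 0 j * (\<Prod>i<N. \<Sum>j. w (Suc i) j)) (A j)" for j
  proof (cases "j \<in> D 0")
    case True
    let ?L = "(\<alpha> - 1) / \<alpha> ^ j"
    have lip: "?L-lipschitz_on UNIV (\<lambda>y. (1 + (\<alpha> - 1) * y) / \<alpha> ^ j)"
    proof (rule lipschitz_onI)
      fix x y :: real
      have "(1 + (\<alpha> - 1) * x) / \<alpha> ^ j - (1 + (\<alpha> - 1) * y) / \<alpha> ^ j = ?L * (x - y)"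
        using alpha_gt_1 by (simp add: field_simps)
      then show "dist ((1 + (\<alpha> - 1) * x) / \<alpha> ^ j) ((1 + (\<alpha> - 1) * y) / \<alpha> ^ j) \<le> ?L * dist x y"
        using alpha_gt_1 by (simp add: dist_real_def abs_mult)
    qed (use alpha_gt_1 in auto)
    have "1 \<le> j" using True Suc.prems[of 0] by auto
    then have "\<alpha> ^ 1 \<le> \<alpha> ^ j" using alpha_gt_1 by (intro power_increasing) auto
    then have "?L \<le> ?r" using alpha_gt_1 by (intro divide_left_mono) auto
    then have "?L * ?r ^ N \<le> ?r ^ Suc N" unfolding power_Suc using alpha_gt_1 by (intro mult_right_mono) auto
    then have "coverable s (?r ^ Suc N) (ennreal (?L powr s) * (\<Prod>i<N. \<Sum>j. w (Suc i) j))
        ((\<lambda>y. (1 + (\<alpha> - 1) * y) / \<alpha> ^ j) ` E)"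
      by (rule coverable_mono[OF coverable_lipschitz_image[OF IH lip assms(1)] order_refl _ order_refl])
    then show ?thesis
      using True by (simp add: A_def w_def)
  next
    case False
    have "coverable s (?r ^ Suc N) 0 ({}::real set)"
      using alpha_gt_1 by (intro coverable_empty) auto
    then show ?thesis using False by (simp add: A_def w_def)
  qed
  then have "coverable s (?r ^ Suc N) (\<Sum>j. w 0 j * (\<Prod>i<N. \<Sum>j. w (Suc i) j)) (\<Union>j. A j)"
    by (rule coverable_UN)
  also have "(\<Sum>j. w 0 j * (\<Prod>i<N. \<Sum>j. w (Suc i) j)) = (\<Prod>i<Suc N. \<Sum>j. w i j)"
    by (simp add: prod.lessThan_Suc_shift del: prod.lessThan_Suc)
  finally have "coverable s (?r ^ Suc N) (\<Prod>i<Suc N. \<Sum>j. w i j) (\<Union>j. A j)" .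
  moreover have "expansion_value \<alpha> ` Pi UNIV D \<subseteq> (\<Union>j. A j)"
  proof clarify
    fix e assume e: "e \<in> Pi UNIV D"
    then have "expansion_value \<alpha> (\<lambda>i. e (Suc i)) \<in> E" unfolding E_def by auto
    moreover have "\<And>i. e i \<ge> 1" using e Suc.prems by (fastforce simp: Pi_iff)
    ultimately have "expansion_value \<alpha> e \<in> A (e 0)"
      using expansion_value_rec[OF alpha_gt_1, of e] e by (auto simp: A_def)
    then show "expansion_value \<alpha> e \<in> (\<Union>j. A j)" by blast
  qed
  ultimately have "coverable s (?r ^ Suc N) (\<Prod>i<Suc N. \<Sum>j. w i j) (expansion_value \<alpha> ` Pi UNIV D)"
    using coverable_mono by blast
  then show ?case unfolding w_def .
qed

end

section \<open>Hausdorff measure from below: mass distribution on digit sequences\<close>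

lemma emeasure_pmf_cylinder:
  fixes p :: "nat \<Rightarrow> 'a pmf"
  shows "emeasure (Pi\<^sub>M UNIV (\<lambda>i. measure_pmf (p i))) {e. \<forall>i<N. e i = c i} =
    ennreal (\<Prod>i<N. pmf (p i) (c i))"
    (is "emeasure ?P _ = _")
    and pmf_cylinder_measurable:
    "{e. \<forall>i<N. e i = c i} \<in> sets (Pi\<^sub>M UNIV (\<lambda>i. measure_pmf (p i)))"
proof -
  interpret product_prob_space "\<lambda>i. measure_pmf (p i)" UNIV by unfold_locales
  have sp: "space ?P = UNIV" by (simp add: space_PiM PiE_UNIV_domain)
  have eq: "{e. \<forall>i<N. e i = c i} = {e \<in> space ?P. \<forall>i\<in>{..<N}. e i \<in> {c i}}"
    by (auto simp: sp)
  show "emeasure ?P {e. \<forall>i<N. e i = c i} = ennreal (\<Prod>i<N. pmf (p i) (c i))"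
    unfolding eq by (subst emeasure_PiM_Collect) (auto simp: emeasure_pmf_single prod_ennreal)
  have "{e \<in> space ?P. \<forall>i\<in>{..<N}. e i \<in> {c i}} \<in> sets ?P"
    by (intro sets.sets_Collect_finite_All sets_Collect_single') auto
  then show "{e. \<forall>i<N. e i = c i} \<in> sets ?P" unfolding eq .
qed

context
  fixes \<alpha> :: real
  assumes alpha_gt_1: "\<alpha> > 1"
begin

lemma expansion_term_le_diameter:
  assumes "bounded V" "\<And>i. e i \<ge> 1" "\<And>i. e' i \<ge> 1"
    "expansion_value \<alpha> e \<in> V" "expansion_value \<alpha> e' \<in> V"
    "\<And>i. i < N \<Longrightarrow> e i = e' i" "e N < e' N"
  shows "expansion_term \<alpha> e (Suc N) \<le> diameter V"
proof -
  have "expansion_term \<alpha> e (Suc N) \<le> dist (expansion_value \<alpha> e) (expansion_value \<alpha> e')"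
    using expansion_value_gap[OF alpha_gt_1, of e e' N] assms by (simp add: dist_real_def)
  also have "\<dots> \<le> diameter V" using assms by (intro diameter_bounded_bound)
  finally show ?thesis .
qed

text \<open>
  All codes of points in \<open>V\<close> agree up to the first position \<open>N\<close> at which two of them differ. They
  lie in one cylinder of level \<open>N\<close>, while \<open>V\<close> is at least as wide as the gap at that position.
  A set with a single code need not have positive diameter, but then the code is a null set because
  the bound tends to 0 along it. The set of codes need not be measurable, so a
  measurable superset \<open>B\<close> takes its place.
\<close>

lemma expansion_codes_measure_bound:
  fixes p :: "nat \<Rightarrow> nat pmf"
  defines "P \<equiv> Pi\<^sub>M UNIV (\<lambda>i. measure_pmf (p i))"
  assumes supp: "\<And>i. set_pmf (p i) \<subseteq> {1..}" and "s > 0" "C > 0"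
    and bound: "\<And>e N. (\<And>i. e i \<in> set_pmf (p i)) \<Longrightarrow>
      (\<Prod>i<N. pmf (p i) (e i)) \<le> C * expansion_term \<alpha> e (Suc N) powr s"
    and "bounded V"
  shows "\<exists>B\<in>sets P. {e. (\<forall>i. e i \<in> set_pmf (p i)) \<and> expansion_value \<alpha> e \<in> V} \<subseteq> B \<and>
    emeasure P B \<le> ennreal C * hausdorff_gauge s V"
proof -
  define W where "W = {e. (\<forall>i. e i \<in> set_pmf (p i)) \<and> expansion_value \<alpha> e \<in> V}"
  have W1: "e i \<ge> 1" if "e \<in> W" for e i using that supp[of i] by (auto simp: W_def)
  consider "W = {}" | e where "W = {e}" | e e' where "e \<in> W" "e' \<in> W" "e \<noteq> e'" by blast
  then have "\<exists>B\<in>sets P. W \<subseteq> B \<and> emeasure P B \<le> ennreal C * hausdorff_gauge s V"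
  proof cases
    case 1
    then show ?thesis by (intro bexI[of _ "{}"]) auto
  next
    case (2 e)
    have e1: "e i \<ge> 1" and ep: "e i \<in> set_pmf (p i)" for i
      using W1[of e i] 2 by (auto simp: W_def)
    have "{e'. \<forall>i. e' i = e i} = (\<Inter>N. {e'. \<forall>i<N. e' i = e i})" by auto
    also have "\<dots> \<in> sets P"
      using pmf_cylinder_measurable[of _ e p] by (intro sets.countable_INT) (auto simp: P_def)
    finally have meas: "{e} \<in> sets P" by (simp flip: fun_eq_iff)
    have "emeasure P {e} \<le> ennreal (C * expansion_term \<alpha> e (Suc N) powr s)" for N
    proof -
      have "emeasure P {e} \<le> emeasure P {e'. \<forall>i<N. e' i = e i}"
        using pmf_cylinder_measurable[of N e p] by (intro emeasure_mono) (auto simp: P_def)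
      also have "\<dots> = ennreal (\<Prod>i<N. pmf (p i) (e i))"
        unfolding P_def by (rule emeasure_pmf_cylinder)
      also have "\<dots> \<le> ennreal (C * expansion_term \<alpha> e (Suc N) powr s)"
        using bound ep by (intro ennreal_leI) auto
      finally show ?thesis .
    qed
    moreover have "(\<lambda>N. ennreal (C * expansion_term \<alpha> e (Suc N) powr s)) \<longlonglongrightarrow> ennreal (C * 0 powr s)"
    proof (intro tendsto_ennrealI tendsto_mult tendsto_const tendsto_powr')
      show "(\<lambda>N. expansion_term \<alpha> e (Suc N)) \<longlonglongrightarrow> 0"
        using expansion_term_summable[OF alpha_gt_1, of e] e1
        by (intro LIMSEQ_Suc summable_LIMSEQ_zero) auto
    qed (use \<open>s > 0\<close> expansion_term_pos[OF alpha_gt_1] in \<open>auto intro!: always_eventually less_imp_le\<close>)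
    ultimately have "emeasure P {e} \<le> ennreal (C * 0 powr s)"
      by (intro LIMSEQ_le_const) auto
    then show ?thesis using 2 meas by (intro bexI[of _ "{e}"]) auto
  next
    case 3
    define N where "N = (LEAST n. \<exists>e\<in>W. \<exists>e'\<in>W. e n \<noteq> e' n)"
    from 3 obtain n where "e n \<noteq> e' n" by auto
    then have "\<exists>n. \<exists>e\<in>W. \<exists>e'\<in>W. e n \<noteq> e' n" using 3 by blast
    then have "\<exists>e\<in>W. \<exists>e'\<in>W. e N \<noteq> e' N" unfolding N_def by (rule LeastI_ex)
    then obtain e e' where W: "e \<in> W" "e' \<in> W" and less: "e N < e' N" by (metis nat_neq_iff)
    have agree: "x i = y i" if "i < N" "x \<in> W" "y \<in> W" for x y i
      using not_less_Least[of i "\<lambda>n. \<exists>e\<in>W. \<exists>e'\<in>W. e n \<noteq> e' n"] that unfolding N_def by blast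
    have "expansion_term \<alpha> e (Suc N) \<le> diameter V"
      using W W1 agree less \<open>bounded V\<close>
      by (intro expansion_term_le_diameter[of V e e' N]) (auto simp: W_def)
    then have "expansion_term \<alpha> e (Suc N) powr s \<le> diameter V powr s"
      using \<open>s > 0\<close> expansion_term_pos[OF alpha_gt_1] by (intro powr_mono2) (auto intro: less_imp_le)
    moreover have "(\<Prod>i<N. pmf (p i) (e i)) \<le> C * expansion_term \<alpha> e (Suc N) powr s"
      using W by (intro bound) (auto simp: W_def)
    ultimately have "(\<Prod>i<N. pmf (p i) (e i)) \<le> C * diameter V powr s"
      using \<open>C > 0\<close> by (meson dual_order.trans less_imp_le mult_left_mono)
    then have "emeasure P {x. \<forall>i<N. x i = e i} \<le> ennreal (C * diameter V powr s)"
      unfolding P_def emeasure_pmf_cylinder by (rule ennreal_leI)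
    also have "\<dots> = ennreal C * hausdorff_gauge s V"
      using W \<open>s > 0\<close> \<open>C > 0\<close> by (auto simp: hausdorff_gauge_def W_def ennreal_mult)
    finally have "emeasure P {x. \<forall>i<N. x i = e i} \<le> ennreal C * hausdorff_gauge s V" .
    moreover have "W \<subseteq> {x. \<forall>i<N. x i = e i}" using agree W by blast
    ultimately show ?thesis using pmf_cylinder_measurable[of N e p]
      by (intro bexI[of _ "{x. \<forall>i<N. x i = e i}"]) (auto simp: P_def)
  qed
  then show ?thesis unfolding W_def .
qed

text \<open>
  The mass distribution principle: almost every code is caught by one of the sets of the cover, so by
  countable subadditivity their measures add up to at least 1.
\<close>

lemma hausdorff_cover_sum_lower_bound:
  fixes p :: "nat \<Rightarrow> nat pmf"
  assumes supp: "\<And>i. set_pmf (p i) \<subseteq> {1..}" and "s > 0" "C > 0"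
    and bound: "\<And>e N. (\<And>i. e i \<in> set_pmf (p i)) \<Longrightarrow>
      (\<Prod>i<N. pmf (p i) (e i)) \<le> C * expansion_term \<alpha> e (Suc N) powr s"
    and sub: "\<And>e. (\<And>i. e i \<in> set_pmf (p i)) \<Longrightarrow> expansion_value \<alpha> e \<in> A"
    and U: "U \<in> hausdorff_covers \<delta> A"
  shows "ennreal (1 / C) \<le> (\<Sum>i. hausdorff_gauge s (U i))"
proof -
  define P where "P = Pi\<^sub>M UNIV (\<lambda>i. measure_pmf (p i))"
  interpret product_prob_space "\<lambda>i. measure_pmf (p i)" UNIV by unfold_locales
  have bd: "bounded (U i)" for i using U by (auto simp: hausdorff_covers_def)
  have "\<forall>i. \<exists>B\<in>sets P. {e. (\<forall>i. e i \<in> set_pmf (p i)) \<and> expansion_value \<alpha> e \<in> U i} \<subseteq> B \<and>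
      emeasure P B \<le> ennreal C * hausdorff_gauge s (U i)"
    unfolding P_def
    by (rule allI, rule expansion_codes_measure_bound, rule supp, fact, fact, rule bound, blast, rule bd)
  then have "\<exists>B. \<forall>i. B i \<in> sets P \<and>
      {e. (\<forall>i. e i \<in> set_pmf (p i)) \<and> expansion_value \<alpha> e \<in> U i} \<subseteq> B i \<and>
      emeasure P (B i) \<le> ennreal C * hausdorff_gauge s (U i)"
    by (intro choice) (simp add: Bex_def)
  then obtain B where B: "\<And>i. B i \<in> sets P"
      "\<And>i. {e. (\<forall>i. e i \<in> set_pmf (p i)) \<and> expansion_value \<alpha> e \<in> U i} \<subseteq> B i"
      "\<And>i. emeasure P (B i) \<le> ennreal C * hausdorff_gauge s (U i)" by blast
  have "AE e in P. \<forall>i. e i \<in> set_pmf (p i)"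
    unfolding AE_all_countable P_def by (auto intro!: AE_component AE_measure_pmf)
  then have "AE e in P. e \<in> (\<Union>i. B i)"
  proof eventually_elim
    case (elim e)
    then have "expansion_value \<alpha> e \<in> A" by (intro sub) auto
    also have "A \<subseteq> (\<Union>i. U i)" using U by (simp add: hausdorff_covers_def)
    finally obtain i where "expansion_value \<alpha> e \<in> U i" by blast
    then show ?case using elim B(2)[of i] by blast
  qed
  then have "1 = emeasure P (\<Union>i. B i)"
    using B(1) unfolding P_def by (intro P.emeasure_eq_1_AE[symmetric]) auto
  also have "\<dots> \<le> (\<Sum>i. emeasure P (B i))"
    using B(1) by (intro emeasure_subadditive_countably) auto
  also have "\<dots> \<le> (\<Sum>i. ennreal C * hausdorff_gauge s (U i))"
    using B(3) by (intro suminf_le) auto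
  also have "\<dots> = ennreal C * (\<Sum>i. hausdorff_gauge s (U i))" by simp
  finally have "ennreal (1 / C) * 1 \<le> ennreal (1 / C) * (ennreal C * (\<Sum>i. hausdorff_gauge s (U i)))"
    by (rule mult_left_mono) simp
  also have "\<dots> = ennreal (1 / C * C) * (\<Sum>i. hausdorff_gauge s (U i))"
    using \<open>C > 0\<close> by (subst ennreal_mult) (auto simp: mult.assoc)
  finally show ?thesis using \<open>C > 0\<close> by simp
qed

end

section \<open>Sets with prescribed digits of given asymptotic mean\<close>

text \<open>
  A limit known only along the sequence \<open>k\<close> extends to all indices for a monotone function:
  \<open>G N / N\<close> is squeezed between \<open>G (k n) / k (n + 2)\<close> and \<open>G (k (n + 2)) / k n\<close> for \<open>n = c N\<close>, and
  both bounds have the limit \<open>L\<close> because \<open>k n\<close> is asymptotic to \<open>n\<close>.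
\<close>

lemma interpolate_ratio_limit:
  fixes G :: "nat \<Rightarrow> real" and k c :: "nat \<Rightarrow> nat"
  assumes "mono G" and "\<And>n. 0 \<le> G n"
    and c: "filterlim c at_top sequentially"
    and between: "\<forall>\<^sub>F N in sequentially. k (c N) \<le> N \<and> N \<le> k (c N + 2)"
    and k: "(\<lambda>n. real (k n) / real n) \<longlonglongrightarrow> 1"
    and G: "(\<lambda>n. G (k n) / real n) \<longlonglongrightarrow> L"
  shows "(\<lambda>N. G N / real N) \<longlonglongrightarrow> L"
proof -
  have r: "(\<lambda>m. real m / real (m + 2)) \<longlonglongrightarrow> 1"
  proof -
    have "(\<lambda>m. 2 / real (m + 2)) \<longlonglongrightarrow> 0"
      using lim_const_over_n[of "2::real"] by (rule LIMSEQ_ignore_initial_segment)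
    then have "(\<lambda>m. 1 - 2 / real (m + 2)) \<longlonglongrightarrow> 1 - 0" by (intro tendsto_intros)
    moreover have "1 - 2 / real (m + 2) = real m / real (m + 2)" for m by (simp add: field_simps)
    ultimately show ?thesis by simp
  qed
  have shift: "(\<lambda>n. G (k (n + 2)) / real (n + 2)) \<longlonglongrightarrow> L" "(\<lambda>n. real (k (n + 2)) / real (n + 2)) \<longlonglongrightarrow> 1"
    using LIMSEQ_ignore_initial_segment[OF G, of 2] LIMSEQ_ignore_initial_segment[OF k, of 2] by auto
  have kpos: "\<forall>\<^sub>F n in sequentially. 0 < k n"
    using order_tendstoD(1)[OF k, of 0] by (rule eventually_mono) (auto intro: gr0I)
  define lo where "lo m = G (k m) / real (k (m + 2))" for m
  define hi where "hi m = G (k (m + 2)) / real (k m)" for m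
  have "(\<lambda>m. (G (k m) / real m) * (real m / real (m + 2)) / (real (k (m + 2)) / real (m + 2))) \<longlonglongrightarrow> L * 1 / 1"
    by (intro tendsto_intros G r shift) auto
  moreover have "\<forall>\<^sub>F m in sequentially. (G (k m) / real m) * (real m / real (m + 2)) / (real (k (m + 2)) / real (m + 2)) = lo m"
    using eventually_gt_at_top[of 0] by eventually_elim (simp add: lo_def)
  ultimately have lo: "lo \<longlonglongrightarrow> L" by (simp add: tendsto_cong)
  have "(\<lambda>m. (G (k (m + 2)) / real (m + 2)) / (real m / real (m + 2)) / (real (k m) / real m)) \<longlonglongrightarrow> L / 1 / 1"
    by (intro tendsto_intros k r shift) auto
  moreover have "\<forall>\<^sub>F m in sequentially. (G (k (m + 2)) / real (m + 2)) / (real m / real (m + 2)) / (real (k m) / real m) = hi m"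
    using eventually_gt_at_top[of 0] by eventually_elim (simp add: hi_def)
  ultimately have hi: "hi \<longlonglongrightarrow> L" by (simp add: tendsto_cong)
  have kc: "\<forall>\<^sub>F N in sequentially. 0 < k (c N)"
    using kpos c by (rule eventually_compose_filterlim)
  show ?thesis
  proof (rule tendsto_sandwich)
    show "(\<lambda>N. lo (c N)) \<longlonglongrightarrow> L" using lo c by (rule filterlim_compose)
    show "(\<lambda>N. hi (c N)) \<longlonglongrightarrow> L" using hi c by (rule filterlim_compose)
    show "\<forall>\<^sub>F N in sequentially. lo (c N) \<le> G N / real N"
      using between kc
    proof eventually_elim
      case (elim N)
      then have "G (k (c N)) \<le> G N" using \<open>mono G\<close> by (auto dest: monoD)
      then show ?case unfolding lo_def using elim assms(2) by (intro frac_le) auto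
    qed
    show "\<forall>\<^sub>F N in sequentially. G N / real N \<le> hi (c N)"
      using between kc
    proof eventually_elim
      case (elim N)
      then have "G N \<le> G (k (c N + 2))" using \<open>mono G\<close> by (auto dest: monoD)
      then show ?case unfolding hi_def using elim assms(2) by (intro frac_le) auto
    qed
  qed
qed

text \<open>
  The exponent is \<open>N\<close> times a sequence with a negative limit. Both halves of the dimension estimate
  have this form once products over positions are written as exponentials of sums.
\<close>

lemma exp_linear_combination_tendsto_0:
  fixes a F :: "nat \<Rightarrow> real"
  assumes "(\<lambda>N. a N / real N) \<longlonglongrightarrow> A" "(\<lambda>N. F N / real N) \<longlonglongrightarrow> B"
    and neg: "x + A * y + B * z < 0"
  shows "(\<lambda>N. exp (real N * x + a N * y + F N * z)) \<longlonglongrightarrow> 0"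
proof -
  have "(\<lambda>N. x + a N / real N * y + F N / real N * z) \<longlonglongrightarrow> x + A * y + B * z"
    by (intro tendsto_intros assms)
  then have "LIM N sequentially. (x + a N / real N * y + F N / real N * z) * real N :> at_bot"
    using neg by (intro filterlim_tendsto_neg_mult_at_bot[OF _ _ filterlim_real_sequentially])
  moreover have "\<forall>\<^sub>F N in sequentially. (x + a N / real N * y + F N / real N * z) * real N =
      real N * x + a N * y + F N * z"
    using eventually_gt_at_top[of 0] by eventually_elim (simp add: field_simps)
  ultimately have "LIM N sequentially. real N * x + a N * y + F N * z :> at_bot"
    by (simp add: filterlim_cong)
  with exp_at_bot show ?thesis by (rule filterlim_compose)
qed

lemma powr_geometric_sums:
  fixes b s :: real
  assumes "b > 1" "s > 0"
  shows "(\<lambda>j. b powr (- s * real (Suc j))) sums (1 / (b powr s - 1))"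
proof -
  define r where "r = b powr (- s)"
  have r: "0 < r" "r < 1" using assms by (auto simp: r_def intro: powr_less_one)
  have "(\<lambda>j. r * r ^ j) sums (r * (1 / (1 - r)))"
    using r by (intro sums_mult geometric_sums) auto
  moreover have "r * r ^ j = b powr (- s * real (Suc j))" for j
    using assms by (simp add: r_def powr_powr powr_add[symmetric] flip: powr_realpow) (simp add: field_simps)
  moreover have "b powr s > 1" using assms by simp
  then have "r * (1 / (1 - r)) = 1 / (b powr s - 1)"
    unfolding r_def powr_minus using assms by (simp add: field_simps)
  ultimately show ?thesis by simp
qed

definition digit_set :: "nat set \<Rightarrow> (nat \<Rightarrow> nat) \<Rightarrow> nat \<Rightarrow> nat set" where
  "digit_set J v i = (if i \<in> J then {1..} else {v i})"

definition free_count :: "nat set \<Rightarrow> nat \<Rightarrow> real" where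
  "free_count J N = (\<Sum>i<N. if i \<in> J then 1 else 0)"

definition prescribed_sum :: "nat set \<Rightarrow> (nat \<Rightarrow> nat) \<Rightarrow> nat \<Rightarrow> real" where
  "prescribed_sum J v N = (\<Sum>i<N. if i \<in> J then 0 else real (v i))"

lemma mono_free_count: "mono (free_count J)"
  unfolding free_count_def by (intro monoI sum_mono2) auto

lemma mono_prescribed_sum: "mono (prescribed_sum J v)"
  unfolding prescribed_sum_def by (intro monoI sum_mono2) auto

context
  fixes \<alpha> \<mu> :: real and J :: "nat set" and v :: "nat \<Rightarrow> nat"
  assumes alpha_gt_1: "\<alpha> > 1"
    and v_pos: "\<And>i. i \<notin> J \<Longrightarrow> 1 \<le> v i"
    and free_density: "(\<lambda>N. free_count J N / real N) \<longlonglongrightarrow> 1"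
    and prescribed_mean: "(\<lambda>N. prescribed_sum J v N / real N) \<longlonglongrightarrow> \<mu>"
begin

text \<open>
  A free position multiplies the gauge sum of the cylinders by \<open>(\<alpha> - 1)\<^sup>s / (\<alpha>\<^sup>s - 1)\<close>, a prescribed
  one by \<open>((\<alpha> - 1) / \<alpha>\<^sup>v)\<^sup>s\<close>. The hypothesis on \<open>s\<close> says that the resulting rate of growth per position
  is negative.
\<close>

lemma hausdorff_measure_prescribed_zero:
  assumes "s > 0" and "((\<alpha> - 1) / \<alpha> powr \<mu>) powr s - \<alpha> powr s + 1 < 0"
  shows "hausdorff_measure s (expansion_value \<alpha> ` Pi UNIV (digit_set J v)) = 0"
proof -
  \<comment> \<open>The logarithm of the factor contributed by position \<open>i\<close>.\<close>
  define w where "w i = (if i \<in> J then s * ln (\<alpha> - 1) - ln (\<alpha> powr s - 1)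
     else s * ln (\<alpha> - 1) - real (v i) * (s * ln \<alpha>))" for i
  have gt: "\<alpha> powr s > 1" using alpha_gt_1 assms(1) by simp
  have pw: "((\<alpha> - 1) / \<alpha> ^ j) powr s = exp (s * ln (\<alpha> - 1) - real j * (s * ln \<alpha>))" for j
    using alpha_gt_1 by (simp add: powr_def ln_div ln_realpow algebra_simps)
  have pw': "((\<alpha> - 1) / \<alpha> ^ j) powr s = (\<alpha> - 1) powr s * \<alpha> powr (- s * real j)" for j
    unfolding pw using alpha_gt_1 by (simp add: powr_def flip: exp_add)
  have digits: "(\<Sum>j. if j \<in> digit_set J v i then ennreal (((\<alpha> - 1) / \<alpha> ^ j) powr s) else 0) =
      ennreal (exp (w i))" for i
  proof (cases "i \<in> J")
    case True
    define g where "g j = (if 1 \<le> j then ((\<alpha> - 1) / \<alpha> ^ j) powr s else 0)" for j :: nat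
    have "g (Suc j) = (\<alpha> - 1) powr s * \<alpha> powr (- s * real (Suc j))" for j
      unfolding g_def pw'[symmetric] by simp
    then have "(\<lambda>j. g (Suc j)) sums ((\<alpha> - 1) powr s * (1 / (\<alpha> powr s - 1)))"
      using sums_mult[OF powr_geometric_sums[OF alpha_gt_1 assms(1)]] by presburger
    then have "g sums ((\<alpha> - 1) powr s * (1 / (\<alpha> powr s - 1)) + g 0)" by (rule sums_Suc)
    then have "(\<Sum>j. ennreal (g j)) = ennreal ((\<alpha> - 1) powr s / (\<alpha> powr s - 1))"
      by (intro suminf_ennreal_eq) (simp_all add: g_def[of 0], simp add: g_def)
    also have "(\<alpha> - 1) powr s / (\<alpha> powr s - 1) = exp (w i)"
      using True gt alpha_gt_1 by (simp add: w_def exp_diff powr_def)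
    also have "(\<lambda>j. ennreal (g j)) = (\<lambda>j. if j \<in> digit_set J v i then ennreal (((\<alpha> - 1) / \<alpha> ^ j) powr s) else 0)"
      using True by (auto simp: g_def digit_set_def)
    finally show ?thesis .
  next
    case False
    have "(\<Sum>j. if j \<in> digit_set J v i then ennreal (((\<alpha> - 1) / \<alpha> ^ j) powr s) else 0) =
      (\<Sum>j\<in>{v i}. if j \<in> digit_set J v i then ennreal (((\<alpha> - 1) / \<alpha> ^ j) powr s) else 0)"
      by (rule suminf_finite) (use False in \<open>auto simp: digit_set_def\<close>)
    also have "\<dots> = ennreal (exp (w i))" using False by (simp add: digit_set_def w_def pw)
    finally show ?thesis .
  qed
  have prod: "(\<Prod>i<N. exp (w i)) = exp (real N * (s * ln (\<alpha> - 1)) +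
      free_count J N * (- ln (\<alpha> powr s - 1)) + prescribed_sum J v N * (- (s * ln \<alpha>)))" for N
  proof -
    have "(\<Sum>i<N. w i) = real N * (s * ln (\<alpha> - 1)) +
      free_count J N * (- ln (\<alpha> powr s - 1)) + prescribed_sum J v N * (- (s * ln \<alpha>))"
      by (induction N) (auto simp: w_def free_count_def prescribed_sum_def algebra_simps)
    then show ?thesis by (simp flip: exp_sum)
  qed
  have neg: "s * ln (\<alpha> - 1) + 1 * (- ln (\<alpha> powr s - 1)) + \<mu> * (- (s * ln \<alpha>)) < 0"
  proof -
    have "ln (((\<alpha> - 1) / \<alpha> powr \<mu>) powr s) < ln (\<alpha> powr s - 1)"
      using assms(2) gt alpha_gt_1 by (subst ln_less_cancel_iff) auto
    also have "ln (((\<alpha> - 1) / \<alpha> powr \<mu>) powr s) = s * (ln (\<alpha> - 1) - \<mu> * ln \<alpha>)"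
      using alpha_gt_1 by (simp add: ln_powr ln_div)
    finally show ?thesis by (simp add: algebra_simps)
  qed
  show ?thesis
  proof (rule hausdorff_measure_zeroI)
    show "coverable s (((\<alpha> - 1) / \<alpha>) ^ N) (ennreal (\<Prod>i<N. exp (w i)))
        (expansion_value \<alpha> ` Pi UNIV (digit_set J v))" for N
      using coverable_expansion_values[OF alpha_gt_1 assms(1), of "digit_set J v" N] v_pos
      unfolding digits by (auto simp: digit_set_def prod_ennreal)
    show "(\<lambda>N. ((\<alpha> - 1) / \<alpha>) ^ N) \<longlonglongrightarrow> 0"
      using alpha_gt_1 by (intro LIMSEQ_power_zero) auto
    show "(\<lambda>N. ennreal (\<Prod>i<N. exp (w i))) \<longlonglongrightarrow> 0"
      unfolding prod ennreal_0[symmetric]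
      by (intro tendsto_ennrealI exp_linear_combination_tendsto_0[OF free_density prescribed_mean neg])
  qed
qed

text \<open>
  Free digits are drawn from \<open>{1..M}\<close> with weights proportional to \<open>\<alpha>\<^sup>-\<^sup>s\<^sup>j\<close>. With these weights the
  free digits enter the measure of a cylinder and the \<open>s\<close>-th power of its length in the same way,
  so their quotient depends only on the numbers of free and of prescribed positions and on the
  prescribed digits, and the hypothesis on \<open>s\<close> makes it decay exponentially. The bound \<open>M\<close> on the
  free digits is needed because the gap that separates two cylinders also involves the next two
  digits.
\<close>

lemma hausdorff_covers_prescribed_lower_bound:
  assumes "s > 0" and "((\<alpha> - 1) / \<alpha> powr \<mu>) powr s - \<alpha> powr s + 1 > 0"
  shows "\<exists>c>0. \<forall>U\<in>hausdorff_covers \<delta> (expansion_value \<alpha> ` Pi UNIV (digit_set J v)).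
    c \<le> (\<Sum>i. hausdorff_gauge s (U i))"
proof -
  define \<theta> where "\<theta> = ((\<alpha> - 1) / \<alpha> powr \<mu>) powr s"
  have \<theta>: "\<theta> > 0" unfolding \<theta>_def using alpha_gt_1 by simp
  have gt: "\<alpha> powr s > 1" using alpha_gt_1 assms(1) by simp
  have "(\<lambda>M. \<Sum>j<M. \<alpha> powr (- s * real (Suc j))) \<longlonglongrightarrow> 1 / (\<alpha> powr s - 1)"
    using powr_geometric_sums[OF alpha_gt_1 assms(1)] by (simp add: sums_def)
  \<comment> \<open>The full geometric series beats \<open>1 / \<theta>\<close>, hence so does a finite section of it.\<close>
  moreover have "1 / \<theta> < 1 / (\<alpha> powr s - 1)"
    using assms(2) gt unfolding \<theta>_def[symmetric] by (intro divide_strict_left_mono) (auto simp: \<theta>)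
  ultimately have "\<forall>\<^sub>F M in sequentially. 1 / \<theta> < (\<Sum>j<M. \<alpha> powr (- s * real (Suc j)))"
    by (rule order_tendstoD)
  then obtain M where M: "1 / \<theta> < (\<Sum>j<M. \<alpha> powr (- s * real (Suc j)))"
    using eventually_happens sequentially_bot by blast
  define S where "S = (\<Sum>j\<in>{1..M}. \<alpha> powr (- s * real j))"
  have "S = (\<Sum>j<M. \<alpha> powr (- s * real (Suc j)))"
    unfolding S_def by (rule sum.reindex_bij_witness[of _ Suc "\<lambda>j. j - 1"]) auto
  then have S1: "1 / \<theta> < S" using M by simp
  have S: "S > 0" using less_trans[OF _ S1] \<theta> by simp
  define g where "g j = (if j \<in> {1..M} then \<alpha> powr (- s * real j) / S else 0)" for j
  define q where "q = embed_pmf g"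
  have gsum: "(\<integral>\<^sup>+j. ennreal (g j) \<partial>count_space UNIV) = 1"
  proof -
    have "(\<integral>\<^sup>+j. ennreal (g j) \<partial>count_space UNIV) = (\<Sum>j\<in>{1..M}. ennreal (g j))"
      by (rule nn_integral_count_space') (auto simp: g_def)
    also have "\<dots> = ennreal (\<Sum>j\<in>{1..M}. g j)"
      using S by (intro sum_ennreal) (auto simp: g_def)
    also have "(\<Sum>j\<in>{1..M}. g j) = S / S"
      unfolding g_def S_def sum_divide_distrib by (rule sum.cong) auto
    finally show ?thesis using S by simp
  qed
  have g0: "g j \<ge> 0" for j using S by (auto simp: g_def)
  have pq: "pmf q j = g j" for j unfolding q_def by (rule pmf_embed_pmf[OF g0 gsum])
  have sq: "set_pmf q = {1..M}" using S alpha_gt_1 by (auto simp: set_pmf_eq pq g_def)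
  define p where "p i = (if i \<in> J then q else return_pmf (v i))" for i
  define a where "a = free_count J"
  define F where "F = prescribed_sum J v"
  let ?T = "s * ln \<alpha>"
  have prod: "(\<Prod>i<N. pmf (p i) (e i)) =
      exp (a N * (- ln S) + F N * ?T - real (\<Sum>i<N. e i) * ?T)"
    if e: "\<And>i. e i \<in> set_pmf (p i)" for e N
  proof (induction N)
    case 0
    then show ?case by (simp add: a_def F_def free_count_def prescribed_sum_def)
  next
    case (Suc N)
    show ?case
    proof (cases "N \<in> J")
      case True
      then have "e N \<in> {1..M}" using e[of N] by (simp add: p_def sq)
      then have "pmf (p N) (e N) = exp (- ln S - real (e N) * ?T)"
        using True S alpha_gt_1 by (simp add: p_def pq g_def powr_def exp_diff exp_minus field_simps)
      then show ?thesis using Suc True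
        by (simp add: a_def F_def free_count_def prescribed_sum_def algebra_simps flip: exp_add)
    next
      case False
      then have "e N = v N" using e[of N] by (simp add: p_def)
      then show ?thesis using Suc False
        by (simp add: p_def a_def F_def free_count_def prescribed_sum_def algebra_simps)
    qed
  qed
  \<comment> \<open>A free digit is at most \<open>M\<close>, and a prescribed one is an increment of \<open>F\<close>.\<close>
  have step: "real (e i) \<le> real M + (F (Suc i) - F i)" if "\<And>i. e i \<in> set_pmf (p i)" for e i
    using that[of i] by (auto simp: p_def sq F_def prescribed_sum_def split: if_splits)
  \<comment> \<open>Up to a constant factor, this bounds the quotient of cylinder measure and gap power.
    The argument \<open>N + 2\<close> accounts for the two digits after the common prefix that enter the gap.\<close>
  have "(\<lambda>N. exp (real N * (- (s * ln (\<alpha> - 1))) + a N * (- ln S) + F (N + 2) * ?T)) \<longlonglongrightarrow> 0"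
  proof (rule exp_linear_combination_tendsto_0)
    show "(\<lambda>N. a N / real N) \<longlonglongrightarrow> 1" unfolding a_def by (rule free_density)
    have "(\<lambda>N. F (N + 2) / real (N + 2)) \<longlonglongrightarrow> \<mu>"
      using prescribed_mean unfolding F_def by (rule LIMSEQ_ignore_initial_segment)
    moreover have "(\<lambda>N. 1 + 2 / real N) \<longlonglongrightarrow> 1 + 0"
      by (intro tendsto_intros lim_const_over_n)
    ultimately have "(\<lambda>N. F (N + 2) / real (N + 2) * (1 + 2 / real N)) \<longlonglongrightarrow> \<mu> * (1 + 0)"
      by (rule tendsto_mult)
    moreover have "\<forall>\<^sub>F N in sequentially. F (N + 2) / real (N + 2) * (1 + 2 / real N) = F (N + 2) / real N"
      using eventually_gt_at_top[of 0]
    proof eventually_elim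
      case (elim N)
      then have "1 + 2 / real N = real (N + 2) / real N" by (simp add: field_simps)
      then show ?case by simp
    qed
    ultimately show "(\<lambda>N. F (N + 2) / real N) \<longlonglongrightarrow> \<mu>" by (simp add: tendsto_cong)
    have "ln (1 / \<theta>) < ln S" using S1 S \<theta> by (subst ln_less_cancel_iff) auto
    moreover have "ln (1 / \<theta>) = - (s * (ln (\<alpha> - 1) - \<mu> * ln \<alpha>))"
      using alpha_gt_1 \<theta> by (simp add: ln_div \<theta>_def ln_powr)
    ultimately show "- (s * ln (\<alpha> - 1)) + 1 * (- ln S) + \<mu> * ?T < 0" by (simp add: algebra_simps)
  qed
  then have "Bseq (\<lambda>N. exp (real N * (- (s * ln (\<alpha> - 1))) + a N * (- ln S) + F (N + 2) * ?T))"
    by (intro convergent_imp_Bseq convergentI)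
  then obtain K where K: "K > 0"
    "\<And>N. exp (real N * (- (s * ln (\<alpha> - 1))) + a N * (- ln S) + F (N + 2) * ?T) \<le> K"
    by (auto elim!: BseqE)
  define C where "C = K * exp (2 * real M * ?T - s * ln (\<alpha> - 1))"
  have C: "C > 0" unfolding C_def using K(1) by simp
  have bound: "(\<Prod>i<N. pmf (p i) (e i)) \<le> C * expansion_term \<alpha> e (Suc N) powr s"
    if e: "\<And>i. e i \<in> set_pmf (p i)" for e N
  proof -
    let ?E = "\<lambda>N. real (\<Sum>i<N. e i)"
    have "?E (N + 2) \<le> ?E N + 2 * real M + (F (N + 2) - F N)"
      using step[OF e, of N] step[OF e, of "Suc N"] by simp
    then have "?E (N + 2) * ?T \<le> (?E N + 2 * real M + (F (N + 2) - F N)) * ?T"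
      using assms(1) alpha_gt_1 by (intro mult_right_mono) auto
    then have "a N * (- ln S) + F N * ?T - ?E N * ?T \<le>
        (real N * (- (s * ln (\<alpha> - 1))) + a N * (- ln S) + F (N + 2) * ?T) +
        (2 * real M * ?T - s * ln (\<alpha> - 1)) +
        (real (Suc N) * (s * ln (\<alpha> - 1)) - ?E (N + 2) * ?T)"
      by (simp add: algebra_simps)
    then have "exp (a N * (- ln S) + F N * ?T - ?E N * ?T) \<le>
        exp (real N * (- (s * ln (\<alpha> - 1))) + a N * (- ln S) + F (N + 2) * ?T) *
        exp (2 * real M * ?T - s * ln (\<alpha> - 1)) *
        exp (real (Suc N) * (s * ln (\<alpha> - 1)) - ?E (N + 2) * ?T)"
      by (simp flip: exp_add)
    also have "\<dots> \<le> C * exp (real (Suc N) * (s * ln (\<alpha> - 1)) - ?E (N + 2) * ?T)"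
      unfolding C_def using K(2) by (intro mult_right_mono) auto
    also have "exp (real (Suc N) * (s * ln (\<alpha> - 1)) - ?E (N + 2) * ?T) = expansion_term \<alpha> e (Suc N) powr s"
    proof -
      have ln_term: "ln (expansion_term \<alpha> e (Suc N)) = real (Suc N) * ln (\<alpha> - 1) - ?E (N + 2) * ln \<alpha>"
        using alpha_gt_1 unfolding expansion_term_def
        by (simp add: ln_div ln_realpow lessThan_Suc_atMost[symmetric] del: sum.atMost_Suc power_Suc)
      have "expansion_term \<alpha> e (Suc N) powr s = exp (s * ln (expansion_term \<alpha> e (Suc N)))"
        using expansion_term_pos[OF alpha_gt_1, of e "Suc N"] by (simp add: powr_def)
      then show ?thesis unfolding ln_term by (simp add: algebra_simps)
    qed
    finally show ?thesis by (simp only: prod[OF e])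
  qed
  have "ennreal (1 / C) \<le> (\<Sum>i. hausdorff_gauge s (U i))"
    if "U \<in> hausdorff_covers \<delta> (expansion_value \<alpha> ` Pi UNIV (digit_set J v))" for U
  proof (rule hausdorff_cover_sum_lower_bound[OF alpha_gt_1 _ assms(1) C _ _ that])
    show "set_pmf (p i) \<subseteq> {1..}" for i using v_pos by (auto simp: p_def sq)
    show "(\<Prod>i<N. pmf (p i) (e i)) \<le> C * expansion_term \<alpha> e (Suc N) powr s"
      if "\<And>i. e i \<in> set_pmf (p i)" for e N
      using that by (rule bound)
    show "expansion_value \<alpha> e \<in> expansion_value \<alpha> ` Pi UNIV (digit_set J v)"
      if e: "\<And>i. e i \<in> set_pmf (p i)" for e
    proof (intro imageI Pi_I)
      show "e i \<in> digit_set J v i" for i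
        using e[of i] by (auto simp: p_def sq digit_set_def split: if_splits)
    qed
  qed
  moreover have "ennreal (1 / C) > 0" using C by simp
  ultimately show ?thesis by blast
qed

end

section \<open>The dimension equation\<close>

text \<open>
  After division by \<open>\<alpha> powr s\<close> the left-hand side becomes \<open>(\<theta> / \<alpha>) powr s + (1 / \<alpha>) powr s - 1\<close>,
  which is strictly decreasing because both bases are below 1.
\<close>

lemma dimension_equation_sign:
  fixes \<alpha> \<theta> d s :: real
  assumes "\<alpha> > 1" "0 < \<theta>" "\<theta> < \<alpha>" and root: "\<theta> powr d - \<alpha> powr d + 1 = 0"
  shows "d < s \<Longrightarrow> \<theta> powr s - \<alpha> powr s + 1 < 0"
    and "s < d \<Longrightarrow> \<theta> powr s - \<alpha> powr s + 1 > 0"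
proof -
  have factor: "\<theta> powr t - \<alpha> powr t + 1 = \<alpha> powr t * ((\<theta> / \<alpha>) powr t + (1 / \<alpha>) powr t - 1)" for t
    using assms by (simp add: powr_divide field_simps)
  have dec: "(\<theta> / \<alpha>) powr y + (1 / \<alpha>) powr y < (\<theta> / \<alpha>) powr x + (1 / \<alpha>) powr x" if "x < y" for x y
    using assms that by (intro add_strict_mono powr_less_mono') auto
  have "(\<theta> / \<alpha>) powr d + (1 / \<alpha>) powr d = 1"
    using root assms(1) unfolding factor by simp
  then show "d < s \<Longrightarrow> \<theta> powr s - \<alpha> powr s + 1 < 0" "s < d \<Longrightarrow> \<theta> powr s - \<alpha> powr s + 1 > 0"
    using dec[of d s] dec[of s d] assms(1) unfolding factor
    by (auto intro!: mult_pos_neg mult_pos_pos)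
qed

lemma dimension_equation_unique_root:
  fixes \<alpha> \<theta> :: real
  assumes "\<alpha> > 1" "0 < \<theta>" "\<theta> < \<alpha> - 1"
  shows "\<exists>!d. d \<in> {0<..<1} \<and> \<theta> powr d - \<alpha> powr d + 1 = 0"
proof (rule ex_ex1I)
  let ?f = "\<lambda>d. \<theta> powr d - \<alpha> powr d + 1"
  have "\<exists>d\<ge>0. d \<le> 1 \<and> ?f d = 0"
    by (rule IVT2') (use assms in \<open>auto intro!: continuous_intros\<close>)
  then obtain d where d: "0 \<le> d" "d \<le> 1" "?f d = 0" by blast
  then have "d \<noteq> 0" "d \<noteq> 1" using assms by auto
  with d show "\<exists>d. d \<in> {0<..<1} \<and> ?f d = 0" by (intro exI[of _ d]) auto
next
  fix d d' assume "d \<in> {0<..<1} \<and> \<theta> powr d - \<alpha> powr d + 1 = 0" "d' \<in> {0<..<1} \<and> \<theta> powr d' - \<alpha> powr d' + 1 = 0"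
  then show "d = d'"
    using dimension_equation_sign(1)[of \<alpha> \<theta> d d'] dimension_equation_sign(1)[of \<alpha> \<theta> d' d] assms
    by (cases d d' rule: linorder_cases) auto
qed

text \<open>
  The values of \<open>m\<close> up to \<open>K\<close> are its first values, so counting them determines their indices. This
  identifies the sum over \<open>i \<le> k n - n\<close> in the theorem with the sum of all prescribed digits at
  positions up to \<open>k n\<close>.
\<close>

lemma strict_mono_image_initial_segment:
  fixes m :: "nat \<Rightarrow> nat"
  assumes "strict_mono_on {1..} m" "m \<in> {1..} \<rightarrow> {1..}"
  shows "m ` {1..} \<inter> {1..K} = m ` {1..card (m ` {1..} \<inter> {1..K})}"
proof -
  have less: "m i < m j" if "1 \<le> i" "i < j" for i j
    using strict_mono_onD[OF assms(1), of i j] that by auto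
  define X where "X = {i\<in>{1..}. m i \<le> K}"
  have inj: "inj_on m {1..}" using assms(1) by (rule strict_mono_on_imp_inj_on)
  have eq: "m ` {1..} \<inter> {1..K} = m ` X" using assms(2) by (auto simp: X_def)
  have "finite (m ` X)" unfolding eq[symmetric] by simp
  moreover have inj_X: "inj_on m X" using inj by (rule inj_on_subset) (auto simp: X_def)
  ultimately have fin: "finite X" by (rule finite_imageD)
  have "X = {1..card X}"
  proof (cases "X = {}")
    case False
    have "X = {1..Max X}"
    proof
      show "X \<subseteq> {1..Max X}" using fin by (auto simp: X_def)
      show "{1..Max X} \<subseteq> X"
      proof
        fix i assume i: "i \<in> {1..Max X}"
        have "Max X \<in> X" using fin False by (rule Max_in)
        then show "i \<in> X" using i less[of i "Max X"] by (cases "i = Max X") (auto simp: X_def)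
      qed
    qed
    then show ?thesis by (metis card_atLeastAtMost diff_Suc_1)
  qed simp
  moreover have "card (m ` X) = card X" using inj_X by (rule card_image)
  ultimately show ?thesis unfolding eq by simp
qed

section \<open>The dimension of the set\<close>

theorem theorem2p3:
  fixes \<alpha> \<mu> :: real and m f k :: "nat \<Rightarrow> nat" and I I' :: "nat set"
  assumes "\<alpha> > 1"
    and "m \<in> {1..} \<rightarrow> {1..}" and "strict_mono_on {1..} m"
    and "I = m ` {1..}" and "I' = {1..} - I" and "infinite I'"
    and "f \<in> I \<rightarrow> {1..}" and "mono_on I f"
    and "k \<in> {1..} \<rightarrow> {1..}" and "\<forall>n\<in>{1..}. card (I' \<inter> {1..k n}) = n"
    and "(\<lambda>n. real (k n) / real n) \<longlonglongrightarrow> 1"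
    and "(\<lambda>n. 1 / real n * (\<Sum>i=1..k n - n. real (f (m i)))) \<longlonglongrightarrow> \<mu>"
    and "\<mu> > 0"
  shows "(\<exists>!d::real. d \<in> {0<..<1} \<and> ((\<alpha> - 1) / \<alpha> powr \<mu>) powr d - \<alpha> powr d + 1 = 0) \<and>
    (\<forall>d\<in>{0<..<1}. ((\<alpha> - 1) / \<alpha> powr \<mu>) powr d - \<alpha> powr d + 1 = 0 \<longrightarrow>
       hausdorff_dim {x\<in>{0<..1}. \<forall>i\<in>{1..}. alpha_digit \<alpha> (m i) x = f (m i)} = ennreal d)"
proof -
  note alpha = \<open>\<alpha> > 1\<close>
  define \<theta> where "\<theta> = (\<alpha> - 1) / \<alpha> powr \<mu>"
  have \<theta>: "0 < \<theta>" "\<theta> < \<alpha> - 1" "\<theta> < \<alpha>"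
  proof -
    show "0 < \<theta>" using alpha by (simp add: \<theta>_def)
    have "\<alpha> powr \<mu> > 1" using alpha \<open>\<mu> > 0\<close> by simp
    then show "\<theta> < \<alpha> - 1" using alpha by (simp add: \<theta>_def divide_less_eq)
    then show "\<theta> < \<alpha>" by simp
  qed
  define J where "J = {i. Suc i \<in> I'}"
  define v where "v i = f (Suc i)" for i
  define E where "E = {x\<in>{0<..1}. \<forall>i\<in>{1..}. alpha_digit \<alpha> (m i) x = f (m i)}"
  have J_iff: "i \<in> J \<longleftrightarrow> Suc i \<notin> I" for i by (auto simp: J_def assms(5))
  have v1: "1 \<le> v i" if "i \<notin> J" for i
    using that assms(7) by (auto simp: J_iff v_def)
  have Suc_image: "(\<lambda>i. Suc i) ` {..<K} = {1..K}" for K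
    by (simp add: image_Suc_lessThan)

  have free: "free_count J K = real (card (I' \<inter> {1..K}))" for K
  proof -
    have "free_count J K = real (card {i\<in>{..<K}. i \<in> J})"
      unfolding free_count_def by (simp add: sum.If_cases Int_def)
    also have "card {i\<in>{..<K}. i \<in> J} = card (Suc ` {i\<in>{..<K}. i \<in> J})"
      by (simp add: card_image)
    also have "Suc ` {i\<in>{..<K}. i \<in> J} = I' \<inter> {1..K}"
      unfolding Suc_image[symmetric] by (auto simp: J_def)
    finally show ?thesis .
  qed
  have prescribed: "prescribed_sum J v K = (\<Sum>i\<in>I \<inter> {1..K}. real (f i))" for K
  proof -
    have "prescribed_sum J v K = (\<Sum>i\<in>{..<K}. if Suc i \<in> I then real (f (Suc i)) else 0)"
      unfolding prescribed_sum_def by (intro sum.cong) (auto simp: J_iff v_def)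
    also have "\<dots> = (\<Sum>i\<in>{1..K}. if i \<in> I then real (f i) else 0)"
      unfolding Suc_image[symmetric] by (subst sum.reindex) auto
    also have "\<dots> = (\<Sum>i\<in>{1..K} \<inter> I. real (f i))" by (simp only: sum.inter_restrict finite_atLeastAtMost)
    finally show ?thesis by (simp only: Int_commute)
  qed

  have card_k: "card (I' \<inter> {1..k n}) = n" if "n \<ge> 1" for n using assms(10) that by simp
  have free_k: "free_count J (k n) = real n" if "n \<ge> 1" for n
    using card_k[OF that] by (simp add: free)
  have prescribed_k: "prescribed_sum J v (k n) = (\<Sum>i=1..k n - n. real (f (m i)))" if "n \<ge> 1" for n
  proof -
    have "I \<subseteq> {1..}" using assms(2,4) by auto
    then have "{1..k n} = (I \<inter> {1..k n}) \<union> (I' \<inter> {1..k n})" "(I \<inter> {1..k n}) \<inter> (I' \<inter> {1..k n}) = {}"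
      by (auto simp: assms(5))
    then have "card {1..k n} = card (I \<inter> {1..k n}) + card (I' \<inter> {1..k n})"
      by (metis card_Un_disjoint finite_Int finite_atLeastAtMost)
    then have "card (I \<inter> {1..k n}) = k n - n" using card_k[OF that] by simp
    then have I_eq: "I \<inter> {1..k n} = m ` {1..k n - n}"
      using strict_mono_image_initial_segment[OF assms(3,2), of "k n"] by (simp add: assms(4))
    have "inj_on m {1..k n - n}"
      using strict_mono_on_imp_inj_on[OF assms(3)] by (rule inj_on_subset) auto
    then show ?thesis unfolding prescribed I_eq by (simp add: sum.reindex)
  qed

  \<comment> \<open>An index \<open>N\<close> with \<open>a N\<close> free positions up to it lies between \<open>k (a N - 1)\<close> and \<open>k (a N + 1)\<close>,
    although \<open>k (a N)\<close> itself may be on either side of it.\<close>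
  define a where "a N = card (I' \<inter> {1..N})" for N
  define c where "c N = a N - 1" for N
  have mono_a: "a N \<le> a N'" if "N \<le> N'" for N N'
    unfolding a_def using that by (intro card_mono) auto
  have a_lim: "filterlim a at_top sequentially"
    unfolding filterlim_at_top
  proof
    fix Z
    have "a (k (Suc Z)) = Suc Z" unfolding a_def by (rule card_k) simp
    then have "Z \<le> a N" if "k (Suc Z) \<le> N" for N using mono_a[OF that] by simp
    then show "\<forall>\<^sub>F N in sequentially. Z \<le> a N" unfolding eventually_sequentially by blast
  qed
  have c_lim: "filterlim c at_top sequentially"
    unfolding filterlim_at_top
  proof
    fix Z
    have "\<forall>\<^sub>F N in sequentially. Suc Z \<le> a N" using a_lim by (simp add: filterlim_at_top)
    then show "\<forall>\<^sub>F N in sequentially. Z \<le> c N" by eventually_elim (simp add: c_def)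
  qed
  have between: "\<forall>\<^sub>F N in sequentially. k (c N) \<le> N \<and> N \<le> k (c N + 2)"
  proof -
    have "\<forall>\<^sub>F N in sequentially. 2 \<le> a N" using a_lim by (simp add: filterlim_at_top)
    then show ?thesis
    proof eventually_elim
      case (elim N)
      then have "1 \<le> c N" by (simp add: c_def)
      then have "a (k (c N)) = c N" "a (k (c N + 2)) = c N + 2"
        unfolding a_def by (simp_all only: card_k trans_le_add1)
      then have "a (k (c N)) < a N" "a N < a (k (c N + 2))" using elim by (auto simp: c_def)
      then show ?case using mono_a by (meson leD le_cases nat_le_linear)
    qed
  qed
  have nonneg: "0 \<le> free_count J n" "0 \<le> prescribed_sum J v n" for n
    by (auto simp: free_count_def prescribed_sum_def intro: sum_nonneg)
  have density: "(\<lambda>N. free_count J N / real N) \<longlonglongrightarrow> 1"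
  proof (rule interpolate_ratio_limit[OF mono_free_count nonneg(1) c_lim between assms(11)])
    have "\<forall>\<^sub>F n in sequentially. 1 = free_count J (k n) / real n"
      using eventually_ge_at_top[of 1] by eventually_elim (simp add: free_k)
    then show "(\<lambda>n. free_count J (k n) / real n) \<longlonglongrightarrow> 1"
      by (rule Lim_transform_eventually[OF tendsto_const])
  qed
  have mean: "(\<lambda>N. prescribed_sum J v N / real N) \<longlonglongrightarrow> \<mu>"
  proof (rule interpolate_ratio_limit[OF mono_prescribed_sum nonneg(2) c_lim between assms(11)])
    have "\<forall>\<^sub>F n in sequentially. 1 / real n * (\<Sum>i=1..k n - n. real (f (m i))) = prescribed_sum J v (k n) / real n"
      using eventually_ge_at_top[of 1] by eventually_elim (simp add: prescribed_k)
    then show "(\<lambda>n. prescribed_sum J v (k n) / real n) \<longlonglongrightarrow> \<mu>"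
      by (rule Lim_transform_eventually[OF assms(12)])
  qed

  have E_eq: "E = expansion_value \<alpha> ` Pi UNIV (digit_set J v)"
  proof (intro set_eqI iffI)
    fix x assume "x \<in> E"
    then have x: "0 < x" "x \<le> 1" and digits: "\<And>i. 1 \<le> i \<Longrightarrow> alpha_digit \<alpha> (m i) x = f (m i)"
      by (auto simp: E_def)
    obtain e where e: "\<And>i. e i \<ge> 1" "expansion_value \<alpha> e = x"
      using expansion_exists[OF alpha x] by blast
    have "e i \<in> digit_set J v i" for i
    proof (cases "i \<in> J")
      case True
      then show ?thesis using e(1)[of i] by (simp add: digit_set_def)
    next
      case False
      then obtain j where j: "1 \<le> j" "Suc i = m j" by (auto simp: J_iff assms(4))
      have "e i = alpha_digit \<alpha> (Suc i) x"
        using alpha_digit_expansion_value[OF alpha, of e i] e by simp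
      then show ?thesis using False digits[OF j(1)] j(2) by (simp add: digit_set_def v_def)
    qed
    then show "x \<in> expansion_value \<alpha> ` Pi UNIV (digit_set J v)" using e(2) by blast
  next
    fix x assume "x \<in> expansion_value \<alpha> ` Pi UNIV (digit_set J v)"
    then obtain e where e: "\<And>i. e i \<in> digit_set J v i" "x = expansion_value \<alpha> e" by blast
    have e1: "1 \<le> e i" for i using e(1)[of i] v1[of i] by (auto simp: digit_set_def split: if_splits)
    have "alpha_digit \<alpha> (m j) x = f (m j)" if "1 \<le> j" for j
    proof -
      have mj: "m j \<in> I" "1 \<le> m j" using that assms(2) by (auto simp: assms(4))
      then obtain i where i: "m j = Suc i" by (cases "m j") auto
      then have "e i = f (Suc i)" using e(1)[of i] mj by (simp add: digit_set_def J_iff v_def)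
      then show ?thesis using alpha_digit_expansion_value[OF alpha, of e i] e1 e(2) i by simp
    qed
    then show "x \<in> E" using expansion_value_bounds[OF alpha, of e] e1 e(2) by (simp add: E_def)
  qed

  have "hausdorff_dim E = ennreal d" if d: "0 < d" "\<theta> powr d - \<alpha> powr d + 1 = 0" for d
  proof (rule antisym)
    note sign = dimension_equation_sign[OF alpha \<theta>(1,3) d(2)]
    show "hausdorff_dim E \<le> ennreal d"
    proof (rule hausdorff_dim_leI)
      show "hausdorff_measure s E = 0" if "d < s" for s
        unfolding E_eq using sign(1)[OF that] d(1) that
        by (intro hausdorff_measure_prescribed_zero[OF alpha v1 density mean]) (auto simp: \<theta>_def)
    qed (use d in simp)
    show "ennreal d \<le> hausdorff_dim E"
    proof (rule hausdorff_dim_geI)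
      show "\<exists>c>0. \<forall>U\<in>hausdorff_covers 1 E. c \<le> (\<Sum>i. hausdorff_gauge t (U i))" if "0 < t" "t < d" for t
        unfolding E_eq using sign(2)[OF that(2)] that(1)
        by (intro hausdorff_covers_prescribed_lower_bound[OF alpha v1 density mean]) (auto simp: \<theta>_def)
    qed
  qed
  then show ?thesis
    using dimension_equation_unique_root[OF alpha \<theta>(1,2)] unfolding E_def \<theta>_def by auto
qed

end
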